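(* Let $r$ be a positive integer and let $A>0$. There is a constant $C_{r,A}>0$ depending only on $r$ and $A$ such that the following holds. Let $(X,\mu)$ be a $\sigma$-finite measure space, let $V$ be a vector space over $\mathbb{R}$, let $\mathfrak{B}:V^2\to\mathbb{C}$ be a positive bilinear form on $V$, let $L$ be a positive integer, and let $f_l:X\to V$, $1\le l\le L$, be maps such that for all $1\le l_1,\dots,l_{2r}\le L$ the function $$\mathfrak{B}(f_{l_1},f_{l_2})\,\mathfrak{B}(f_{l_3},f_{l_4})\cdots\mathfrak{B}(f_{l_{2r-1}},f_{l_{2r}})$$ is measurable and integrable on $X$. Suppose that $$\int_X \mathfrak{B}(f_{l_1},f_{l_2})\cdots\mathfrak{B}(f_{l_{2r-1}},f_{l_{2r}})\,d\mu=0\quad\text{whenever } l_1,\dots,l_{2r}\in\{1,\dots,L\}\text{ are all distinct,}$$ and that $$\Big\|\Big(\sum_{l=1}^L\mathfrak{B}(f_l)^{2r}\Big)^{\frac1{2r}}\Big\|_{2r}\le A\,\Big\|\mathfrak{B}\Big(\sum_{l=1}^L f_l\Big)\Big\|_{2r}.$$ Then $$\Big\|\Big(\sum_{l=1}^L\mathfrak{B}(f_l)^2\Big)^{1/2}\Big\|_{2r}\le C_{r,A}\,\Big\|\mathfrak{B}\Big(\sum_{l=1}^L f_l\Big)\Big\|_{2r}.$$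
   Context: A bilinear form $\mathfrak{B}:V^2\to\mathbb{C}$ on a real vector space $V$ (bilinear over $\mathbb{R}$) is called positive if $\mathfrak{B}(v,v)\ge 0$ (in particular real) for all $v\in V$; it is not assumed symmetric or definite. For such a form and a single vector $v$, write $\mathfrak{B}(v):=\mathfrak{B}(v,v)^{1/2}$. For functions into $V$ these expressions are taken pointwise, e.g. $\mathfrak{B}(f_l,f_m)(x)=\mathfrak{B}(f_l(x),f_m(x))$ and $\mathfrak{B}(f_l)(x)=\mathfrak{B}(f_l(x))$. $\|\cdot\|_{2r}$ is the $L^{2r}(X,d\mu)$ norm. *)

theory Defs
  imports "HOL-Analysis.Analysis"
begin

text \<open>Neither symmetry nor definiteness is required.  The predicate \<open>bilinear\<close> means bilinear
  over the reals, here with values in the real vector space of complex numbers.\<close>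

definition positive_form :: "('v::real_vector \<Rightarrow> 'v \<Rightarrow> complex) \<Rightarrow> bool" where
  "positive_form B \<longleftrightarrow> bilinear B \<and> (\<forall>v. B v v \<in> \<real> \<and> 0 \<le> Re (B v v))"

text \<open>The quantity \<open>B(v) = B(v,v)\<^sup>1\<^sup>/\<^sup>2\<close>.  For a positive form \<open>B v v\<close> is a nonnegative real
  number, so that taking the real part discards nothing.\<close>

definition form_root :: "('v \<Rightarrow> 'v \<Rightarrow> complex) \<Rightarrow> 'v \<Rightarrow> real" where
  "form_root B v = sqrt (Re (B v v))"

text \<open>The \<open>L\<^sup>p\<close> norm of a real function, for a finite exponent \<open>p\<close>.  The Bochner integral of a
  non-integrable function is 0, so this is the norm only on \<open>L\<^sup>p\<close>.  In the theorem the
  integrability hypotheses force all three functions whose norm is taken to lie in \<open>L\<^sup>p\<close>, with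
  \<open>p = 2r\<close>: each \<open>2r\<close>-th power is a finite sum of the functions assumed to be integrable.\<close>

definition Lp_norm :: "'a measure \<Rightarrow> real \<Rightarrow> ('a \<Rightarrow> real) \<Rightarrow> real" where
  "Lp_norm M p f = (\<integral>x. \<bar>f x\<bar> powr p \<partial>M) powr (1 / p)"

text \<open>The product \<open>B(f\<^bsub>l(1)\<^esub>, f\<^bsub>l(2)\<^esub>) B(f\<^bsub>l(3)\<^esub>, f\<^bsub>l(4)\<^esub>) \<dots> B(f\<^bsub>l(2r-1)\<^esub>, f\<^bsub>l(2r)\<^esub>)\<close>
  as a function on the measure space.\<close>

definition form_prod ::
  "('v \<Rightarrow> 'v \<Rightarrow> complex) \<Rightarrow> (nat \<Rightarrow> 'a \<Rightarrow> 'v) \<Rightarrow> nat \<Rightarrow> (nat \<Rightarrow> nat) \<Rightarrow> 'a \<Rightarrow> complex" where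
  "form_prod B f r l x = (\<Prod>i = 1..r. B (f (l (2 * i - 1)) x) (f (l (2 * i)) x))"

text \<open>A constant depending only on \<open>r\<close> and \<open>A\<close> must in particular be independent of the types that
  carry the measure space and the vector space.  HOL cannot quantify over these types inside a
  formula, so an existential quantifier over the constant would by itself allow a different
  constant for each choice of types.  Bounding the constant by the following expression, in which
  no type variable occurs, excludes this.  Its precise (and far from optimal) value is immaterial.
  It comes from expanding sums over distinct indices as signed sums over the \<open>(2r)!\<close> permutations
  of the \<open>2r\<close> positions.\<close>

definition const_bound :: "nat \<Rightarrow> real \<Rightarrow> real" where
  "const_bound r A = (fact (2 * r) * (1 + A)) ^ (2 * r)"

end

theory Submission
  imports Defs "HOL-Combinatorics.Orbits" "HOL-Combinatorics.Permutations" "HOL-Library.Multiset"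
begin

text \<open>Symmetrizing \<open>B\<close> changes neither \<open>B(v,v)\<close> nor the hypotheses, so \<open>B\<close> may be taken to be a
  real positive semidefinite symmetric form, for which the Cauchy-Schwarz inequality holds.  Write
  \<open>S = \<Sum> f\<^sub>l\<close> and \<open>Q\<^sup>2 = \<Sum> B(f\<^sub>l)\<^sup>2\<close>.  The sum of the products over tuples of distinct indices
  equals the sum over all permutations \<open>\<sigma>\<close> of the \<open>2r\<close> positions of \<open>sgn \<sigma>\<close> times the sum
  \<open>T(\<sigma>)\<close> of the products over the tuples invariant under \<open>\<sigma>\<close>.
  If \<open>\<sigma>\<close> has \<open>a \<ge> 1\<close> fixed points, then \<open>|T(\<sigma>)| \<le> B(S)\<^sup>a Q\<^sup>2\<^sup>r\<^sup>-\<^sup>a\<close>; if it has none, but has a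
  cycle of length at least 3, then \<open>|T(\<sigma>)| \<le> max B(f\<^sub>l) Q\<^sup>2\<^sup>r\<^sup>-\<^sup>1\<close>.  The remaining permutations are
  the fixed-point free involutions: they all have the same sign, all their sums \<open>T(\<sigma>)\<close> are
  nonnegative, and one of these sums is \<open>Q\<^sup>2\<^sup>r\<close>.  This bounds \<open>Q\<^sup>2\<^sup>r\<close> pointwise by a multiple of the sum over
  distinct tuples, whose integral vanishes, plus a multiple of \<open>B(S)\<^sup>2\<^sup>r + \<Sum> B(f\<^sub>l)\<^sup>2\<^sup>r\<close>.\<close>

section \<open>Sums over distinct indices\<close>

text \<open>If \<open>l\<close> takes one value at two positions, composition with their
  transposition is a sign-reversing involution of the stabilizer, so the signs cancel in pairs. An
  injective \<open>l\<close> is stabilized by the identity only.\<close>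

lemma sum_sign_stabilizer:
  fixes l :: "'i \<Rightarrow> 'b"
  assumes fin: "finite I"
  shows "(\<Sum>\<sigma> | \<sigma> permutes I \<and> (\<forall>i\<in>I. l (\<sigma> i) = l i). sign \<sigma>) = (if inj_on l I then 1 else 0)"
proof (cases "inj_on l I")
  case True
  have "\<sigma> = id" if s: "\<sigma> permutes I" "\<forall>i\<in>I. l (\<sigma> i) = l i" for \<sigma>
  proof
    fix i
    show "\<sigma> i = id i"
    proof (cases "i \<in> I")
      case True
      then have "\<sigma> i \<in> I" "l (\<sigma> i) = l i" using s by (auto simp: permutes_in_image)
      then show ?thesis using \<open>inj_on l I\<close> True by (simp add: inj_on_eq_iff)
    next
      case False
      then show ?thesis using s by (simp add: permutes_not_in)
    qed
  qed
  then have "{\<sigma>. \<sigma> permutes I \<and> (\<forall>i\<in>I. l (\<sigma> i) = l i)} = {id}"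
    by (auto simp: permutes_id)
  then show ?thesis using True by simp
next
  case False
  then obtain a b where ab: "a \<in> I" "b \<in> I" "a \<noteq> b" "l a = l b" by (auto simp: inj_on_def)
  define S where "S = {\<sigma>. \<sigma> permutes I \<and> (\<forall>i\<in>I. l (\<sigma> i) = l i)}"
  define \<tau> where "\<tau> = Transposition.transpose a b"
  have tp: "\<tau> permutes I" unfolding \<tau>_def using ab by (intro permutes_swap_id)
  have tau2: "\<tau> \<circ> \<tau> = id" by (simp add: \<tau>_def)
  have lt: "l (\<tau> i) = l i" for i using ab by (auto simp: \<tau>_def Transposition.transpose_def)
  have maps: "\<tau> \<circ> \<sigma> \<in> S" if "\<sigma> \<in> S" for \<sigma>
    using that tp lt by (auto simp: S_def intro: permutes_compose)
  have inv: "\<tau> \<circ> (\<tau> \<circ> \<sigma>) = \<sigma>" for \<sigma> :: "'i \<Rightarrow> 'i" by (metis comp_assoc tau2 id_comp)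
  have bij: "bij_betw (\<lambda>\<sigma>. \<tau> \<circ> \<sigma>) S S"
    by (rule bij_betw_byWitness[where f' = "\<lambda>\<sigma>. \<tau> \<circ> \<sigma>"]) (use maps inv in auto)
  have "sum sign S = (\<Sum>\<sigma>\<in>S. sign (\<tau> \<circ> \<sigma>))"
    by (rule sum.reindex_bij_betw[OF bij, symmetric])
  also have "\<dots> = (\<Sum>\<sigma>\<in>S. - sign \<sigma>)"
  proof (rule sum.cong)
    fix \<sigma> assume "\<sigma> \<in> S"
    then have "permutation \<sigma>" "permutation \<tau>"
      using tp fin by (auto simp: S_def permutation_permutes)
    then show "sign (\<tau> \<circ> \<sigma>) = - sign \<sigma>" using ab by (simp add: sign_compose \<tau>_def sign_swap_id)
  qed simp
  also have "\<dots> = - sum sign S" by (simp add: sum_negf)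
  finally show ?thesis using False by (simp add: S_def)
qed

text \<open>The indicator of injectivity is replaced by the signed count of stabilizing
  permutations; exchanging the two sums leaves, for each \<sigma>, a sum over invariant
  tuples.\<close>

lemma sum_inj_eq_signed_sum:
  fixes T :: "('i \<Rightarrow> 'b) \<Rightarrow> real"
  assumes fin: "finite I" "finite A"
  shows "(\<Sum>l | l \<in> I \<rightarrow>\<^sub>E A \<and> inj_on l I. T l) =
    (\<Sum>\<sigma> | \<sigma> permutes I. of_int (sign \<sigma>) * (\<Sum>l | l \<in> I \<rightarrow>\<^sub>E A \<and> (\<forall>i\<in>I. l (\<sigma> i) = l i). T l))"
proof -
  have finP: "finite (I \<rightarrow>\<^sub>E A)" using fin by (intro finite_PiE) auto
  have finS: "finite {\<sigma>. \<sigma> permutes I}" using fin by (simp add: finite_permutations)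
  have "(\<Sum>l | l \<in> I \<rightarrow>\<^sub>E A \<and> inj_on l I. T l) = (\<Sum>l\<in>I \<rightarrow>\<^sub>E A. of_int (if inj_on l I then 1 else 0) * T l)"
    by (rule sum.mono_neutral_cong_left) (use finP in auto)
  also have "\<dots> = (\<Sum>l\<in>I \<rightarrow>\<^sub>E A. \<Sum>\<sigma> | \<sigma> permutes I \<and> (\<forall>i\<in>I. l (\<sigma> i) = l i). of_int (sign \<sigma>) * T l)"
    by (simp add: sum_sign_stabilizer[OF fin(1), symmetric] sum_distrib_right)
  also have "\<dots> = (\<Sum>l\<in>I \<rightarrow>\<^sub>E A. \<Sum>\<sigma> | \<sigma> permutes I. if \<forall>i\<in>I. l (\<sigma> i) = l i then of_int (sign \<sigma>) * T l else 0)"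
    by (intro sum.cong refl sum.mono_neutral_cong_left) (use finS in auto)
  also have "\<dots> = (\<Sum>\<sigma> | \<sigma> permutes I. \<Sum>l\<in>I \<rightarrow>\<^sub>E A. if \<forall>i\<in>I. l (\<sigma> i) = l i then of_int (sign \<sigma>) * T l else 0)"
    by (rule sum.swap)
  also have "\<dots> = (\<Sum>\<sigma> | \<sigma> permutes I. of_int (sign \<sigma>) * (\<Sum>l | l \<in> I \<rightarrow>\<^sub>E A \<and> (\<forall>i\<in>I. l (\<sigma> i) = l i). T l))"
    unfolding sum_distrib_left
    by (intro sum.cong refl sum.mono_neutral_cong_right) (use finP in auto)
  finally show ?thesis .
qed

section \<open>Orbit representatives of a permutation\<close>

definition orbit_rep :: "(nat \<Rightarrow> nat) \<Rightarrow> nat \<Rightarrow> nat" where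
  "orbit_rep \<sigma> i = Min (orbit \<sigma> i)"

context
  fixes \<sigma> :: "nat \<Rightarrow> nat" and I :: "nat set"
  assumes perm: "\<sigma> permutes I" and fin: "finite I"
begin

lemma perm_permutation: "permutation \<sigma>" using perm fin by (auto simp: permutation_permutes)

lemma orbit_rep_in_orbit: "orbit_rep \<sigma> i \<in> orbit \<sigma> i"
  unfolding orbit_rep_def
  by (intro Min_in finite_orbit permutation_self_in_orbit orbit_nonempty perm_permutation)

lemma orbit_rep_step: "orbit_rep \<sigma> (\<sigma> i) = orbit_rep \<sigma> i"
  by (simp add: orbit_rep_def permutation_orbit_step[OF perm_permutation])

lemma orbit_rep_orbit: "j \<in> orbit \<sigma> i \<Longrightarrow> orbit_rep \<sigma> j = orbit_rep \<sigma> i"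
  by (induction rule: orbit.induct) (simp_all add: orbit_rep_step)

lemma orbit_rep_idem: "orbit_rep \<sigma> (orbit_rep \<sigma> i) = orbit_rep \<sigma> i"
  by (rule orbit_rep_orbit[OF orbit_rep_in_orbit])

lemma orbit_rep_mem: "i \<in> I \<Longrightarrow> orbit_rep \<sigma> i \<in> I"
  using permutes_orbit_subset[OF perm] orbit_rep_in_orbit by blast

lemma orbit_rep_fixed: "\<sigma> i = i \<Longrightarrow> orbit_rep \<sigma> i = i"
proof -
  assume fx: "\<sigma> i = i"
  have "j = i" if "j \<in> orbit \<sigma> i" for j using that by (induction rule: orbit.induct) (use fx in auto)
  then show ?thesis using orbit_rep_in_orbit by blast
qed

text \<open>This trades \<sigma> for the idempotent map \<open>orbit_rep \<sigma>\<close>. Tuples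
  invariant under an idempotent map are parametrized by free tuples on its image.\<close>

lemma invariant_iff_orbit_rep:
  "(\<forall>i\<in>I. l (\<sigma> i) = l i) \<longleftrightarrow> (\<forall>i\<in>I. l (orbit_rep \<sigma> i) = l i)"
proof
  assume inv: "\<forall>i\<in>I. l (\<sigma> i) = l i"
  have "j \<in> orbit \<sigma> i \<Longrightarrow> i \<in> I \<Longrightarrow> l j = l i \<and> j \<in> I" for i j
    by (induction rule: orbit.induct) (use inv perm in \<open>auto simp: permutes_in_image\<close>)
  then show "\<forall>i\<in>I. l (orbit_rep \<sigma> i) = l i" using orbit_rep_in_orbit by blast
next
  assume inv: "\<forall>i\<in>I. l (orbit_rep \<sigma> i) = l i"
  then show "\<forall>i\<in>I. l (\<sigma> i) = l i" by (metis orbit_rep_step perm permutes_in_image)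
qed

text \<open>The orbit of a fixed point is a singleton. Hence an index attached to a fixed point
  occurs in one slot only.\<close>

lemma orbit_rep_eq_fixed:
  assumes "\<sigma> x = x" "orbit_rep \<sigma> i = x" shows "i = x"
proof -
  have "x \<in> orbit \<sigma> i" using assms orbit_rep_in_orbit by metis
  then have "i \<in> orbit \<sigma> x"
    by (metis orbit_swap perm_permutation permutation_self_in_orbit)
  then show ?thesis by (induction rule: orbit.induct) (use assms(1) in auto)
qed

lemma orbit_rep_involution:
  assumes "\<sigma> (\<sigma> i) = i" "orbit_rep \<sigma> j = orbit_rep \<sigma> i" shows "j = i \<or> j = \<sigma> i"
proof -
  have "j \<in> orbit \<sigma> i"
    by (metis assms(2) orbit_rep_in_orbit orbit_swap orbit_trans perm_permutation permutation_self_in_orbit)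
  then show ?thesis by (induction rule: orbit.induct) (use assms(1) in auto)
qed

end

text \<open>An invariant tuple is recovered from its restriction to the image of \<rho> by
  composition with \<rho>. The assumption \<open>cong\<close> bridges the values outside
  \<open>I\<close>: extensional tuples are \<open>undefined\<close> there, while
  \<open>\<lambda>i. k (\<rho> i)\<close> need not be.\<close>

lemma sum_invariant_reindex:
  fixes h :: "('i \<Rightarrow> 'b) \<Rightarrow> real"
  assumes idem: "\<And>i. i \<in> I \<Longrightarrow> \<rho> (\<rho> i) = \<rho> i" and mem: "\<And>i. i \<in> I \<Longrightarrow> \<rho> i \<in> I"
    and cong: "\<And>l l'. (\<And>i. i \<in> I \<Longrightarrow> l i = l' i) \<Longrightarrow> h l = h l'"
  shows "(\<Sum>l | l \<in> I \<rightarrow>\<^sub>E A \<and> (\<forall>i\<in>I. l (\<rho> i) = l i). h l) = (\<Sum>k\<in>\<rho> ` I \<rightarrow>\<^sub>E A. h (\<lambda>i. k (\<rho> i)))"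
proof (rule sum.reindex_bij_witness[where i = "\<lambda>k. restrict (\<lambda>i. k (\<rho> i)) I" and j = "\<lambda>l. restrict l (\<rho> ` I)"])
  fix l assume l: "l \<in> {l. l \<in> I \<rightarrow>\<^sub>E A \<and> (\<forall>i\<in>I. l (\<rho> i) = l i)}"
  show "restrict (\<lambda>i. restrict l (\<rho> ` I) (\<rho> i)) I = l"
    using l by (intro ext) (auto simp: restrict_def PiE_def extensional_def)
  show "restrict l (\<rho> ` I) \<in> \<rho> ` I \<rightarrow>\<^sub>E A" using l mem by auto
  show "h (\<lambda>i. restrict l (\<rho> ` I) (\<rho> i)) = h l" by (rule cong) (use l in auto)
next
  fix k assume k: "k \<in> \<rho> ` I \<rightarrow>\<^sub>E A"
  show "restrict (restrict (\<lambda>i. k (\<rho> i)) I) (\<rho> ` I) = k"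
    using k mem idem by (intro ext) (auto simp: restrict_def PiE_def extensional_def)
  show "restrict (\<lambda>i. k (\<rho> i)) I \<in> {l. l \<in> I \<rightarrow>\<^sub>E A \<and> (\<forall>i\<in>I. l (\<rho> i) = l i)}"
    using k mem idem by auto
qed

lemma sum_PiE_insert:
  fixes h :: "('i \<Rightarrow> 'b) \<Rightarrow> real"
  assumes "x \<notin> W"
  shows "(\<Sum>k\<in>insert x W \<rightarrow>\<^sub>E A. h k) = (\<Sum>k\<in>W \<rightarrow>\<^sub>E A. \<Sum>m\<in>A. h (k(x := m)))"
proof -
  have "(\<Sum>k\<in>insert x W \<rightarrow>\<^sub>E A. h k) = (\<Sum>(m, k)\<in>A \<times> (W \<rightarrow>\<^sub>E A). h (k(x := m)))"
    unfolding PiE_insert_eq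
    by (subst sum.reindex[OF inj_combinator[OF assms]]) (auto simp: case_prod_unfold)
  also have "\<dots> = (\<Sum>m\<in>A. \<Sum>k\<in>W \<rightarrow>\<^sub>E A. h (k(x := m)))"
    by (simp add: sum.cartesian_product)
  also have "\<dots> = (\<Sum>k\<in>W \<rightarrow>\<^sub>E A. \<Sum>m\<in>A. h (k(x := m)))" by (rule sum.swap)
  finally show ?thesis .
qed

text \<open>Induction on the number of two-cycles: composing with the transposition of one of them
  removes it and reverses the sign.\<close>

lemma sign_fixpoint_free_involution:
  fixes \<sigma> :: "nat \<Rightarrow> nat"
  assumes "finite J" "\<sigma> permutes J" "\<And>i. i \<in> J \<Longrightarrow> \<sigma> i \<noteq> i" "\<And>i. \<sigma> (\<sigma> i) = i" "card J = 2 * n"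
  shows "sign \<sigma> = (-1) ^ n"
  using assms
proof (induction n arbitrary: J \<sigma>)
  case 0
  then have "\<sigma> = id" by (simp add: permutes_empty)
  then show ?case by simp
next
  case (Suc n)
  then obtain i where i: "i \<in> J" by fastforce
  define j where "j = \<sigma> i"
  have j: "j \<in> J" "j \<noteq> i" "\<sigma> j = i" using Suc i by (auto simp: j_def permutes_in_image)
  define \<sigma>' where "\<sigma>' = Transposition.transpose i j \<circ> \<sigma>"
  have notin: "\<sigma> k \<noteq> i \<and> \<sigma> k \<noteq> j" if "k \<noteq> i" "k \<noteq> j" for k
    using Suc.prems(4) j j_def that by metis
  have eq: "\<sigma>' k = (if k = i \<or> k = j then k else \<sigma> k)" for k
  proof -
    have "\<sigma>' i = i" by (simp add: \<sigma>'_def j_def[symmetric])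
    moreover have "\<sigma>' j = j" using j(3) by (simp add: \<sigma>'_def)
    moreover have "\<sigma>' k = \<sigma> k" if "k \<noteq> i" "k \<noteq> j"
      using notin[OF that] by (simp add: \<sigma>'_def Transposition.transpose_def)
    ultimately show ?thesis by auto
  qed
  have "\<sigma>' permutes J" unfolding \<sigma>'_def using Suc i j by (intro permutes_compose permutes_swap_id)
  then have p: "\<sigma>' permutes J - {i, j}"
    by (rule permutes_superset) (auto simp: eq)
  have "sign \<sigma>' = (-1) ^ n"
  proof (rule Suc.IH[OF _ p])
    show "finite (J - {i, j})" using Suc by simp
    show "\<sigma>' k \<noteq> k" if "k \<in> J - {i, j}" for k using that Suc by (auto simp: eq)
    show "\<sigma>' (\<sigma>' k) = k" for k using Suc.prems(4) notin by (auto simp: eq)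
    show "card (J - {i, j}) = 2 * n" using Suc i j by (simp add: card_Diff_subset)
  qed
  moreover have "sign \<sigma>' = - sign \<sigma>"
    unfolding \<sigma>'_def using perm_permutation[OF Suc.prems(2,1)] j
    by (simp add: sign_compose permutation_swap_id sign_swap_id)
  ultimately show ?case by simp
qed

section \<open>Sums over two-regular multigraphs\<close>

text \<open>Exponents are shifted by one: \<open>kernel_pow G A n\<close> is the power \<open>n + 1\<close> of the matrix \<open>G\<close>.\<close>

fun kernel_pow :: "('b \<Rightarrow> 'b \<Rightarrow> real) \<Rightarrow> 'b set \<Rightarrow> nat \<Rightarrow> 'b \<Rightarrow> 'b \<Rightarrow> real" where
  "kernel_pow G A 0 i j = G i j"
| "kernel_pow G A (Suc n) i j = (\<Sum>k\<in>A. G i k * kernel_pow G A n k j)"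

text \<open>The triple \<open>(u, v, a)\<close> is an edge between \<open>u\<close> and \<open>v\<close> that carries \<open>kernel_pow G A a\<close>.\<close>

fun edge_val :: "('b \<Rightarrow> 'b \<Rightarrow> real) \<Rightarrow> 'b set \<Rightarrow> ('w \<Rightarrow> 'b) \<Rightarrow> 'w \<times> 'w \<times> nat \<Rightarrow> real" where
  "edge_val G A k (u, v, a) = kernel_pow G A a (k u) (k v)"

text \<open>With a multiset a loop contributes its vertex twice, so summing the ends over all edges
  records the degrees of the graph.\<close>

fun edge_ends :: "'w \<times> 'w \<times> nat \<Rightarrow> 'w multiset" where
  "edge_ends (u, v, a) = {#u, v#}"

context
  fixes G :: "'b \<Rightarrow> 'b \<Rightarrow> real" and A :: "'b set"
  assumes finA: "finite A" and sym: "\<And>i j. G i j = G j i"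
    and psd: "\<And>x. 0 \<le> (\<Sum>i\<in>A. \<Sum>j\<in>A. x i * G i j * x j)"
begin

text \<open>In the shifted notation the matrix powers \<open>a + 1\<close> and \<open>b + 1\<close>
  multiply to the power \<open>a + b + 2\<close>, whence the \<open>Suc\<close>.\<close>

lemma kernel_pow_add:
  "(\<Sum>k\<in>A. kernel_pow G A a i k * kernel_pow G A b k j) = kernel_pow G A (Suc (a + b)) i j"
proof (induction a arbitrary: i)
  case (Suc a)
  have "(\<Sum>k\<in>A. kernel_pow G A (Suc a) i k * kernel_pow G A b k j)
      = (\<Sum>k\<in>A. \<Sum>m\<in>A. G i m * (kernel_pow G A a m k * kernel_pow G A b k j))"
    by (simp add: sum_distrib_right mult.assoc)
  also have "\<dots> = (\<Sum>m\<in>A. \<Sum>k\<in>A. G i m * (kernel_pow G A a m k * kernel_pow G A b k j))"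
    by (rule sum.swap)
  also have "\<dots> = (\<Sum>m\<in>A. G i m * kernel_pow G A (Suc (a + b)) m j)"
    by (simp only: sum_distrib_left[symmetric] Suc)
  finally show ?case by simp
qed simp

lemma kernel_pow_sym: "kernel_pow G A a i j = kernel_pow G A a j i"
proof (induction a arbitrary: i j)
  case (Suc a)
  have "kernel_pow G A (Suc a) i j = (\<Sum>k\<in>A. kernel_pow G A a i k * kernel_pow G A 0 k j)"
    by (subst kernel_pow_add) simp
  also have "\<dots> = (\<Sum>k\<in>A. G j k * kernel_pow G A a k i)"
    using Suc[of i] by (intro sum.cong) (auto simp: sym[of j])
  finally show ?case by simp
qed (simp add: sym)

text \<open>An even power of \<open>G\<close> is the square of a symmetric matrix, so its diagonal
  entries are sums of squares. An odd power beyond the first is \<open>G\<close> between two equal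
  powers, and its diagonal entry is the quadratic form of \<open>G\<close> at a row of that power.
  For the first power a unit vector serves.\<close>

lemma kernel_pow_diag_nonneg:
  assumes "i \<in> A"
  shows "0 \<le> kernel_pow G A n i i"
proof (cases "even n")
  case False
  then obtain m where n: "n = Suc (m + m)" by (metis mult_2 odd_two_times_div_two_succ Suc_eq_plus1)
  have "kernel_pow G A n i i = (\<Sum>k\<in>A. kernel_pow G A m i k * kernel_pow G A m i k)"
    unfolding n by (subst kernel_pow_add[symmetric]) (simp add: kernel_pow_sym[of m i])
  then show ?thesis by (simp add: sum_nonneg)
next
  case True
  show ?thesis
  proof (cases n)
    case 0
    have "(\<Sum>a\<in>A. \<Sum>b\<in>A. (if a = i then 1 else 0) * G a b * (if b = i then 1 else 0))
        = (\<Sum>a\<in>A. if a = i then G i i else 0)"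
      using finA assms by (intro sum.cong refl) (auto simp: if_distrib[of "\<lambda>x. _ * x"] cong: if_cong)
    also have "\<dots> = G i i" using finA assms by simp
    finally show ?thesis using psd[of "\<lambda>a. if a = i then 1 else 0"] 0 by simp
  next
    case (Suc n')
    with True have "odd n'" by simp
    then obtain m where n: "n = Suc (m + Suc (0 + m))"
      using Suc by (metis mult_2 odd_two_times_div_two_succ Suc_eq_plus1 add_0 add_Suc_right)
    have "kernel_pow G A n i i = (\<Sum>k\<in>A. kernel_pow G A m i k * (\<Sum>j\<in>A. G k j * kernel_pow G A m j i))"
      unfolding n by (subst kernel_pow_add[symmetric]) simp
    also have "\<dots> = (\<Sum>k\<in>A. \<Sum>j\<in>A. kernel_pow G A m i k * G k j * kernel_pow G A m i j)"
      by (simp add: sum_distrib_left mult.assoc kernel_pow_sym[of m i])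
    finally show ?thesis using psd[of "kernel_pow G A m i"] by simp
  qed
qed

text \<open>Symmetry of the kernel allows an edge to be read from either end.\<close>

lemma edge_at:
  assumes "w \<in># edge_ends e"
  obtains u a where "edge_ends e = {#w, u#}"
    "\<And>k. edge_val G A k e = kernel_pow G A a (k w) (k u)"
proof (cases e)
  case (fields x y a)
  show ?thesis
  proof (cases "w = x")
    case True
    then show ?thesis using that[of y a] fields by simp
  next
    case False
    then have "w = y" using assms fields by auto
    then show ?thesis using that[of x a] fields by (simp add: kernel_pow_sym[of a] add_mset_commute)
  qed
qed

lemma edge_val_upd_notin: "w \<notin># edge_ends e \<Longrightarrow> edge_val G A (k(w := m)) e = edge_val G A k e"
  by (cases e) auto

lemma prod_edge_val_upd_notin:
  assumes "w \<notin># \<Sum>\<^sub># (image_mset edge_ends es)"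
  shows "(\<Prod>e\<in>#es. edge_val G A (k(w := m)) e) = (\<Prod>e\<in>#es. edge_val G A k e)"
  using assms by (intro arg_cong[of _ _ prod_mset] image_mset_cong edge_val_upd_notin) auto

lemma edge_containing:
  assumes "w \<in># \<Sum>\<^sub># (image_mset edge_ends es)"
  obtains e es' where "w \<in># edge_ends e" "es = add_mset e es'"
proof -
  obtain e where "e \<in># es" "w \<in># edge_ends e"
    using assms by (auto simp: in_Union_mset_iff)
  then show ?thesis using that by (meson multi_member_split)
qed

text \<open>Summing out a vertex merges its two edges into one, whose exponent is the sum of theirs; a
  vertex with a loop contributes the trace of a power of \<open>G\<close>.\<close>

lemma two_regular_sum_nonneg:
  assumes "finite W" "\<Sum>\<^sub># (image_mset edge_ends es) = mset_set W + mset_set W"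
  shows "0 \<le> (\<Sum>k\<in>W \<rightarrow>\<^sub>E A. \<Prod>e\<in>#es. edge_val G A k e)"
  using assms
proof (induction W arbitrary: es rule: finite_induct)
  case empty
  have "es = {#}"
  proof (rule ccontr)
    assume "es \<noteq> {#}"
    then obtain e es' where "es = add_mset e es'" by (meson multiset_cases)
    then show False using empty by (cases e) auto
  qed
  then show ?case by simp
next
  case (insert w W)
  let ?E = "\<lambda>es. \<Sum>\<^sub># (image_mset edge_ends es)"
  have tot: "?E es = add_mset w (add_mset w (mset_set W + mset_set W))"
    using insert by simp
  then have "w \<in># ?E es" by simp
  then obtain e es1 where e: "w \<in># edge_ends e" "es = add_mset e es1"
    by (rule edge_containing)
  obtain u a where ua: "edge_ends e = {#w, u#}" "\<And>k. edge_val G A k e = kernel_pow G A a (k w) (k u)"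
    using edge_at[OF e(1)] by blast
  \<comment> \<open>Reading this edge towards \<open>w\<close>, and the other one away from
    \<open>w\<close>, turns the sum over the value at \<open>w\<close> into a matrix
    product.\<close>
  have ua2: "edge_val G A k e = kernel_pow G A a (k u) (k w)" for k
    by (simp only: ua(2) kernel_pow_sym[of a "k w"])
  have tot1: "add_mset u (?E es1) = add_mset w (mset_set W + mset_set W)"
    using tot e ua by simp
  have wW: "w \<notin># mset_set W + mset_set W" using insert by simp
  show ?case
  proof (cases "u = w")
    case True
    then have E: "?E es1 = mset_set W + mset_set W" using tot1 by simp
    have "(\<Sum>k\<in>insert w W \<rightarrow>\<^sub>E A. \<Prod>e\<in>#es. edge_val G A k e)
        = (\<Sum>k\<in>W \<rightarrow>\<^sub>E A. \<Sum>m\<in>A. kernel_pow G A a m m * (\<Prod>e\<in>#es1. edge_val G A k e))"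
      using insert(2) wW by (simp add: sum_PiE_insert e ua True prod_edge_val_upd_notin E)
    also have "\<dots> = (\<Sum>m\<in>A. kernel_pow G A a m m) * (\<Sum>k\<in>W \<rightarrow>\<^sub>E A. \<Prod>e\<in>#es1. edge_val G A k e)"
      unfolding sum_product by (rule sum.swap)
    also have "\<dots> \<ge> 0"
      by (intro insert(3)[OF E] mult_nonneg_nonneg[OF sum_nonneg[OF kernel_pow_diag_nonneg]])
    finally show ?thesis .
  next
    case False
    then have "w \<in># ?E es1" using tot1 by (metis insert_noteq_member)
    then obtain e' es2 where e': "w \<in># edge_ends e'" "es1 = add_mset e' es2"
      by (rule edge_containing)
    obtain v b where vb: "edge_ends e' = {#w, v#}" "\<And>k. edge_val G A k e' = kernel_pow G A b (k w) (k v)"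
      using edge_at[OF e'(1)] by blast
    have tot2: "add_mset u (add_mset v (?E es2)) = mset_set W + mset_set W"
      using tot1 e' vb by (simp add: add_mset_commute)
    \<comment> \<open>The edges \<open>e\<close> and \<open>e'\<close> use up both occurrences of
      \<open>w\<close>.\<close>
    then have v: "v \<noteq> w" and n2: "w \<notin># ?E es2"
      using wW by (metis union_single_eq_member add_mset_commute, metis insert_iff set_mset_add_mset_insert)
    define es' where "es' = add_mset (u, v, Suc (a + b)) es2"
    have E: "?E es' = mset_set W + mset_set W" using tot2 by (simp add: es'_def)
    have "(\<Sum>k\<in>insert w W \<rightarrow>\<^sub>E A. \<Prod>e\<in>#es. edge_val G A k e)
        = (\<Sum>k\<in>W \<rightarrow>\<^sub>E A. \<Sum>m\<in>A. (kernel_pow G A a (k u) m * kernel_pow G A b m (k v)) * (\<Prod>e\<in>#es2. edge_val G A k e))"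
      using insert(2) False v n2
      by (simp add: sum_PiE_insert e ua2 e' vb prod_edge_val_upd_notin mult.assoc)
    also have "\<dots> = (\<Sum>k\<in>W \<rightarrow>\<^sub>E A. \<Prod>e\<in>#es'. edge_val G A k e)"
      by (simp only: sum_distrib_right[symmetric] kernel_pow_add) (simp add: es'_def)
    also have "\<dots> \<ge> 0" by (rule insert(3)[OF E])
    finally show ?thesis .
  qed
qed

end

section \<open>Products of a positive semidefinite form\<close>

text \<open>The slots hold vectors rather than indices, so that one of them can receive the sum of
  all \<open>f m\<close>; this is how a free index is summed out.\<close>

definition pair_prod :: "('v \<Rightarrow> 'v \<Rightarrow> real) \<Rightarrow> nat \<Rightarrow> (nat \<Rightarrow> 'v) \<Rightarrow> real" where
  "pair_prod B r g = (\<Prod>i = 1..r. B (g (2 * i - 1)) (g (2 * i)))"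

lemma pair_prod_cong: "(\<And>i. i \<in> {1..2 * r} \<Longrightarrow> g i = h i) \<Longrightarrow> pair_prod B r g = pair_prod B r h"
  unfolding pair_prod_def
proof (intro prod.cong refl)
  fix j assume gh: "\<And>i. i \<in> {1..2 * r} \<Longrightarrow> g i = h i" and "j \<in> {1..r}"
  then have "g (2 * j - 1) = h (2 * j - 1)" "g (2 * j) = h (2 * j)" by (intro gh; auto)+
  then show "B (g (2 * j - 1)) (g (2 * j)) = B (h (2 * j - 1)) (h (2 * j))" by simp
qed

lemma prod_atLeastAtMost_pairs:
  fixes n :: "nat \<Rightarrow> 'a::comm_monoid_mult"
  shows "(\<Prod>i = 1..r. n (2 * i - 1) * n (2 * i)) = (\<Prod>i = 1..2 * r. n i)"
  by (induction r) (simp_all add: mult.assoc)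

text \<open>Every \<open>b m\<close> is at most the l2 norm of \<open>b\<close>; this bounds
  \<open>c - 2\<close> of the factors and leaves the sum of squares.\<close>

lemma sum_power_le_sqrt_power:
  fixes b :: "'b \<Rightarrow> real"
  assumes "finite A" "\<And>m. m \<in> A \<Longrightarrow> 0 \<le> b m" "c \<ge> 2"
  shows "(\<Sum>m\<in>A. b m ^ c) \<le> sqrt (\<Sum>m\<in>A. (b m)\<^sup>2) ^ c"
proof -
  let ?q = "sqrt (\<Sum>m\<in>A. (b m)\<^sup>2)"
  obtain d where c: "c = d + 2" using assms(3) by (metis le_add_diff_inverse2)
  have bq: "b m \<le> ?q" if "m \<in> A" for m
    using assms that by (intro real_le_rsqrt member_le_sum) auto
  have "(\<Sum>m\<in>A. b m ^ c) \<le> (\<Sum>m\<in>A. ?q ^ d * (b m)\<^sup>2)"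
    unfolding c power_add using assms(2) bq by (intro sum_mono mult_right_mono power_mono) auto
  also have "\<dots> = ?q ^ d * ?q\<^sup>2"
    by (simp add: sum_distrib_left[symmetric] sum_nonneg)
  finally show ?thesis unfolding c power_add .
qed

text \<open>One factor is bounded by \<open>R\<close>, and the l2 estimate handles the rest.\<close>

lemma sum_power_le_bound_mult_sqrt_power:
  fixes b :: "'b \<Rightarrow> real"
  assumes "finite A" "\<And>m. m \<in> A \<Longrightarrow> 0 \<le> b m" "\<And>m. m \<in> A \<Longrightarrow> b m \<le> R" "c \<ge> 2"
  shows "(\<Sum>m\<in>A. b m ^ Suc c) \<le> R * sqrt (\<Sum>m\<in>A. (b m)\<^sup>2) ^ c"
proof (cases "A = {}")
  case False
  \<comment> \<open>A member of \<open>A\<close> is what makes \<open>R\<close> nonnegative; for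
    empty \<open>A\<close> both sides are zero.\<close>
  then have R: "0 \<le> R" using assms(2,3) by (metis all_not_in_conv order_trans)
  have "(\<Sum>m\<in>A. b m ^ Suc c) \<le> (\<Sum>m\<in>A. R * b m ^ c)"
    unfolding power_Suc using assms by (intro sum_mono mult_right_mono) auto
  also have "\<dots> \<le> R * sqrt (\<Sum>m\<in>A. (b m)\<^sup>2) ^ c"
    unfolding sum_distrib_left[symmetric]
    using assms R by (intro mult_left_mono sum_power_le_sqrt_power) auto
  finally show ?thesis .
qed (use assms in \<open>auto simp: power_0_left\<close>)

text \<open>If \<open>y \<le> q / c\<close>, at least one factor \<open>1 / c\<close> is gained
  against \<open>q ^ n\<close>; otherwise \<open>q < c * y\<close> turns every \<open>q\<close> into
  \<open>c * y\<close>. A large \<open>c\<close> later makes the first summand small enough to be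
  absorbed.\<close>

lemma weighted_power_absorb:
  fixes y q c :: real
  assumes "0 \<le> y" "0 \<le> q" "1 \<le> c" "1 \<le> a" "a \<le> n"
  shows "y ^ a * q ^ (n - a) \<le> q ^ n / c + c ^ (n - 1) * y ^ n"
proof (cases "c * y \<le> q")
  case True
  then have "y \<le> q / c" using assms by (simp add: field_simps)
  then have "y ^ a * q ^ (n - a) \<le> (q / c) ^ a * q ^ (n - a)"
    using assms by (intro mult_right_mono power_mono) auto
  also have "\<dots> = q ^ n / c ^ a" using assms by (simp add: power_divide flip: power_add)
  also have "\<dots> \<le> q ^ n / c"
    using assms by (intro divide_left_mono) (auto simp: self_le_power)
  finally show ?thesis using assms by (simp add: add_increasing2)
next
  case False
  then have "y ^ a * q ^ (n - a) \<le> y ^ a * (c * y) ^ (n - a)"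
    using assms by (intro mult_left_mono power_mono) auto
  also have "\<dots> = c ^ (n - a) * y ^ n" using assms by (simp add: power_mult_distrib flip: power_add)
  also have "\<dots> \<le> c ^ (n - 1) * y ^ n"
    using assms by (intro mult_right_mono power_increasing) auto
  finally show ?thesis using assms by (simp add: add_increasing)
qed

section \<open>The seminorm of a positive semidefinite form\<close>

locale psd_form =
  fixes B :: "'v::real_vector \<Rightarrow> 'v \<Rightarrow> real"
  assumes bilin: "bilinear B" and sym: "B v w = B w v" and nonneg [simp]: "0 \<le> B v v"
begin

abbreviation nrm :: "'v \<Rightarrow> real" where "nrm v \<equiv> sqrt (B v v)"

lemma nrm_nonneg [simp]: "0 \<le> nrm v" using nonneg by simp

lemma cauchy_schwarz: "\<bar>B v w\<bar> \<le> nrm v * nrm w"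
proof -
  have expand: "0 \<le> B v v + 2 * t * B v w + t\<^sup>2 * B w w" for t
  proof -
    have "B (v + t *\<^sub>R w) (v + t *\<^sub>R w) = B v v + 2 * t * B v w + t\<^sup>2 * B w w"
      using bilin sym[of w v]
      by (simp add: bilinear_ladd bilinear_radd bilinear_lmul bilinear_rmul algebra_simps power2_eq_square)
    then show ?thesis using nonneg[of "v + t *\<^sub>R w"] by simp
  qed
  have "(B v w)\<^sup>2 \<le> B v v * B w w"
  proof (cases "B w w = 0")
    case True
    \<comment> \<open>With \<open>B w w = 0\<close> the polynomial in \<open>t\<close> is affine; if
      it were not constant, the \<open>t\<close> chosen below would give it the value -1.\<close>
    have "B v w = 0"
    proof (rule ccontr)
      assume "B v w \<noteq> 0"
      then have "2 * (- (B v v + 1) / (2 * B v w)) * B v w = - (B v v + 1)" by simp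
      then show False using expand[of "- (B v v + 1) / (2 * B v w)"] True by simp
    qed
    then show ?thesis using True by simp
  next
    case False
    then have pos: "0 < B w w" using nonneg[of w] by linarith
    \<comment> \<open>This \<open>t\<close> minimizes the polynomial.\<close>
    have "2 * (- B v w / B w w) * B v w + (- B v w / B w w)\<^sup>2 * B w w = - ((B v w)\<^sup>2 / B w w)"
      using pos by (simp add: power2_eq_square)
    then have "(B v w)\<^sup>2 / B w w \<le> B v v" using expand[of "- B v w / B w w"] by linarith
    then show ?thesis using pos by (simp add: pos_divide_le_eq)
  qed
  then have "sqrt ((B v w)\<^sup>2) \<le> sqrt (B v v * B w w)" by (rule real_sqrt_le_mono)
  then show ?thesis by (simp add: real_sqrt_mult)
qed

lemma abs_pair_prod_le: "\<bar>pair_prod B r g\<bar> \<le> (\<Prod>i = 1..2 * r. nrm (g i))"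
proof -
  have "\<bar>pair_prod B r g\<bar> \<le> (\<Prod>i = 1..r. nrm (g (2 * i - 1)) * nrm (g (2 * i)))"
    unfolding pair_prod_def abs_prod by (intro prod_mono) (auto simp: cauchy_schwarz)
  then show ?thesis by (simp only: prod_atLeastAtMost_pairs[where n = "\<lambda>i. nrm (g i)"])
qed

lemma sum_left: "B (\<Sum>m\<in>A. h m) w = (\<Sum>m\<in>A. B (h m) w)"
  using linear_sum[of "\<lambda>v. B v w" h A] bilin by (simp add: bilinear_def)

lemma sum_right: "B v (\<Sum>m\<in>A. h m) = (\<Sum>m\<in>A. B v (h m))"
  using linear_sum[of "B v" h A] bilin by (simp add: bilinear_def)

lemma pair_prod_slot_sum:
  assumes x: "x \<in> {1..2 * r}"
  shows "pair_prod B r (g(x := \<Sum>m\<in>A. h m)) = (\<Sum>m\<in>A. pair_prod B r (g(x := h m)))"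
proof -
  \<comment> \<open>The slot \<open>x\<close> belongs to pair number \<open>j\<close>, and no other
    pair involves it.\<close>
  define j where "j = (x + 1) div 2"
  have j: "j \<in> {1..r}" using x by (auto simp: j_def)
  have xj: "x = 2 * j - 1 \<or> x = 2 * j" by (auto simp: j_def)
  have split: "pair_prod B r (g(x := v)) = B ((g(x := v)) (2 * j - 1)) ((g(x := v)) (2 * j)) *
      (\<Prod>i \<in> {1..r} - {j}. B (g (2 * i - 1)) (g (2 * i)))" for v
  proof -
    have "(\<Prod>i \<in> {1..r} - {j}. B ((g(x := v)) (2 * i - 1)) ((g(x := v)) (2 * i)))
        = (\<Prod>i \<in> {1..r} - {j}. B (g (2 * i - 1)) (g (2 * i)))"
    proof (rule prod.cong)
      fix i assume "i \<in> {1..r} - {j}"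
      then have "2 * i - 1 \<noteq> x \<and> 2 * i \<noteq> x"
        using xj j unfolding Diff_iff atLeastAtMost_iff singleton_iff by arith
      then show "B ((g(x := v)) (2 * i - 1)) ((g(x := v)) (2 * i)) = B (g (2 * i - 1)) (g (2 * i))" by simp
    qed simp
    then show ?thesis unfolding pair_prod_def using j by (subst prod.remove[of _ j]) auto
  qed
  have "2 * j - 1 \<noteq> 2 * j" using j by auto
  then show ?thesis using xj
    unfolding split by (auto simp: sum_left sum_right sum_distrib_right)
qed

text \<open>The index at a fixed point occurs in one slot only, so summing over it fills that slot
  with the sum of all \<open>f m\<close>. The induction runs on the set \<open>D\<close> of
  positions still to be summed out; \<open>D = F\<close> is the case of interest.\<close>

lemma sum_pair_prod_free:
  assumes "finite D" "D \<subseteq> F" "F \<subseteq> {1..2 * r}" "D \<inter> W = {}"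
    and rep: "\<And>i x. x \<in> F \<Longrightarrow> \<rho> i = x \<longleftrightarrow> i = x"
  shows "(\<Sum>k\<in>D \<union> W \<rightarrow>\<^sub>E A. pair_prod B r (\<lambda>i. if i \<in> F - D then \<Sum>m\<in>A. f m else f (k (\<rho> i))))
    = (\<Sum>k\<in>W \<rightarrow>\<^sub>E A. pair_prod B r (\<lambda>i. if i \<in> F then \<Sum>m\<in>A. f m else f (k (\<rho> i))))"
  using assms(1,2,4)
proof (induction D rule: finite_induct)
  case (insert x D)
  let ?S = "\<Sum>m\<in>A. f m"
  let ?g = "\<lambda>k i. if i \<in> F - D then ?S else f (k (\<rho> i))"
  have x: "x \<in> F" "x \<notin> D \<union> W" "x \<in> {1..2 * r}" using insert assms(3) by auto
  have upd: "(\<lambda>i. if i \<in> F - insert x D then ?S else f ((k(x := m)) (\<rho> i))) = (?g k)(x := f m)" for k m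
    using rep[OF x(1)] by (auto simp: fun_eq_iff)
  have upd': "(?g k)(x := ?S) = ?g k" for k using x by (auto simp: fun_eq_iff)
  have "(\<Sum>k\<in>insert x D \<union> W \<rightarrow>\<^sub>E A. pair_prod B r (\<lambda>i. if i \<in> F - insert x D then ?S else f (k (\<rho> i))))
      = (\<Sum>k\<in>D \<union> W \<rightarrow>\<^sub>E A. \<Sum>m\<in>A. pair_prod B r ((?g k)(x := f m)))"
    unfolding Un_insert_left by (subst sum_PiE_insert[OF x(2)]) (simp only: upd)
  also have "\<dots> = (\<Sum>k\<in>D \<union> W \<rightarrow>\<^sub>E A. pair_prod B r (?g k))"
    by (simp only: pair_prod_slot_sum[OF x(3), symmetric] upd')
  also have "\<dots> = (\<Sum>k\<in>W \<rightarrow>\<^sub>E A. pair_prod B r (\<lambda>i. if i \<in> F then ?S else f (k (\<rho> i))))"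
    using insert by (intro insert.IH) auto
  finally show ?case .
qed simp

end

section \<open>Estimates for sums over invariant tuples\<close>

lemma sum_PiE_prod_fibers:
  fixes b :: "'b \<Rightarrow> real"
  assumes "finite J" "finite W" "finite A" "\<rho> ` J \<subseteq> W"
  shows "(\<Sum>k\<in>W \<rightarrow>\<^sub>E A. \<Prod>i\<in>J. b (k (\<rho> i))) = (\<Prod>w\<in>W. \<Sum>m\<in>A. b m ^ card {i\<in>J. \<rho> i = w})"
proof -
  have "(\<Prod>i\<in>J. b (k (\<rho> i))) = (\<Prod>w\<in>W. b (k w) ^ card {i\<in>J. \<rho> i = w})" for k
  proof -
    have "(\<Prod>i\<in>J. b (k (\<rho> i))) = (\<Prod>w\<in>W. \<Prod>i\<in>{i\<in>J. \<rho> i = w}. b (k (\<rho> i)))"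
      by (rule prod.group[symmetric]) (use assms in auto)
    also have "\<dots> = (\<Prod>w\<in>W. b (k w) ^ card {i\<in>J. \<rho> i = w})"
      by (intro prod.cong refl) simp
    finally show ?thesis .
  qed
  then show ?thesis using assms by (simp add: prod_sum_PiE)
qed

text \<open>From here on a point of the measure space is fixed, so \<open>f\<close> is a finite
  family of vectors. This sum is the \<open>T(\<sigma>)\<close> of the outline, and
  \<open>square_fn\<close> is its \<open>Q\<close>.\<close>

definition perm_sum ::
  "('v \<Rightarrow> 'v \<Rightarrow> real) \<Rightarrow> 'b set \<Rightarrow> ('b \<Rightarrow> 'v) \<Rightarrow> nat \<Rightarrow> (nat \<Rightarrow> nat) \<Rightarrow> real" where
  "perm_sum B A f r \<sigma> =
    (\<Sum>l | l \<in> {1..2 * r} \<rightarrow>\<^sub>E A \<and> (\<forall>i\<in>{1..2 * r}. l (\<sigma> i) = l i). pair_prod B r (\<lambda>i. f (l i)))"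

definition square_fn :: "('v \<Rightarrow> 'v \<Rightarrow> real) \<Rightarrow> 'b set \<Rightarrow> ('b \<Rightarrow> 'v) \<Rightarrow> real" where
  "square_fn B A f = sqrt (\<Sum>m\<in>A. (sqrt (B (f m) (f m)))\<^sup>2)"

definition max_nrm :: "('v \<Rightarrow> 'v \<Rightarrow> real) \<Rightarrow> 'b set \<Rightarrow> ('b \<Rightarrow> 'v) \<Rightarrow> real" where
  "max_nrm B A f = Max ((\<lambda>m. sqrt (B (f m) (f m))) ` A)"

context psd_form
begin

context
  fixes A :: "'b set" and f :: "'b \<Rightarrow> 'v" and r :: nat
  assumes finA: "finite A"
begin

lemma square_fn_nonneg: "0 \<le> square_fn B A f" by (simp add: square_fn_def sum_nonneg nonneg)

lemma nrm_le_max: "m \<in> A \<Longrightarrow> nrm (f m) \<le> max_nrm B A f"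
  unfolding max_nrm_def using finA by simp

text \<open>The maximum is attained, so its power is one of the summands. For
  \<open>n = 2 * r\<close> the integral of the sum is what the norm hypothesis controls.\<close>

lemma max_nrm_power_le:
  assumes neA: "A \<noteq> {}"
  shows "max_nrm B A f ^ n \<le> (\<Sum>m\<in>A. nrm (f m) ^ n)"
proof -
  have "max_nrm B A f \<in> (\<lambda>m. nrm (f m)) ` A"
    unfolding max_nrm_def using finA neA by (intro Max_in) auto
  then obtain m where "m \<in> A" "max_nrm B A f = nrm (f m)" by auto
  then show ?thesis using finA member_le_sum[of m A "\<lambda>m. nrm (f m) ^ n"] by (simp add: nonneg)
qed

lemma perm_sum_orbit_rep:
  assumes "\<sigma> permutes {1..2 * r}"
  shows "perm_sum B A f r \<sigma> = (\<Sum>k\<in>orbit_rep \<sigma> ` {1..2 * r} \<rightarrow>\<^sub>E A. pair_prod B r (\<lambda>i. f (k (orbit_rep \<sigma> i))))"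
  unfolding perm_sum_def invariant_iff_orbit_rep[OF assms finite_atLeastAtMost]
proof (rule sum_invariant_reindex)
  show "orbit_rep \<sigma> i \<in> {1..2 * r}" if "i \<in> {1..2 * r}" for i
    by (rule orbit_rep_mem[OF assms finite_atLeastAtMost that])
  show "pair_prod B r (\<lambda>i. f (l i)) = pair_prod B r (\<lambda>i. f (l' i))"
    if "\<And>i. i \<in> {1..2 * r} \<Longrightarrow> l i = l' i" for l l'
    using that by (intro pair_prod_cong) simp
qed (rule orbit_rep_idem[OF assms finite_atLeastAtMost])

text \<open>Each fixed point is an orbit of its own, whose index is summed out by linearity. Indices
  remain only for the nontrivial orbits, represented by \<open>W\<close>.\<close>

lemma perm_sum_fixed_points:
  assumes \<sigma>: "\<sigma> permutes {1..2 * r}" and F: "F = {i\<in>{1..2 * r}. \<sigma> i = i}"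
    and W: "W = orbit_rep \<sigma> ` {1..2 * r} - F"
  shows "perm_sum B A f r \<sigma> = (\<Sum>k\<in>W \<rightarrow>\<^sub>E A. pair_prod B r (\<lambda>i. if i \<in> F then \<Sum>m\<in>A. f m else f (k (orbit_rep \<sigma> i))))"
proof -
  have fx: "orbit_rep \<sigma> x = x" if "x \<in> F" for x
    using that F orbit_rep_fixed[OF \<sigma> finite_atLeastAtMost] by auto
  have U: "orbit_rep \<sigma> ` {1..2 * r} = F \<union> W"
  proof -
    have "x \<in> orbit_rep \<sigma> ` {1..2 * r}" if "x \<in> F" for x
      using F fx[OF that] that by (metis (no_types, lifting) image_eqI mem_Collect_eq)
    then show ?thesis unfolding W by blast
  qed
  have "(\<Sum>k\<in>F \<union> W \<rightarrow>\<^sub>E A. pair_prod B r (\<lambda>i. if i \<in> F - F then \<Sum>m\<in>A. f m else f (k (orbit_rep \<sigma> i))))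
    = (\<Sum>k\<in>W \<rightarrow>\<^sub>E A. pair_prod B r (\<lambda>i. if i \<in> F then \<Sum>m\<in>A. f m else f (k (orbit_rep \<sigma> i))))"
  proof (rule sum_pair_prod_free)
    show "orbit_rep \<sigma> i = x \<longleftrightarrow> i = x" if "x \<in> F" for i x
    proof
      have "\<sigma> x = x" using that F by auto
      then show "i = x" if "orbit_rep \<sigma> i = x"
        using that by (rule orbit_rep_eq_fixed[OF \<sigma> finite_atLeastAtMost])
    qed (use fx that in auto)
  qed (use F W in auto)
  then show ?thesis unfolding perm_sum_orbit_rep[OF \<sigma>] U by simp
qed

lemma orbit_rep_nonfixed:
  assumes \<sigma>: "\<sigma> permutes {1..2 * r}" and F: "F = {i\<in>{1..2 * r}. \<sigma> i = i}" and i: "i \<in> {1..2 * r} - F"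
  shows "orbit_rep \<sigma> i \<notin> F"
proof
  assume rF: "orbit_rep \<sigma> i \<in> F"
  then have "\<sigma> (orbit_rep \<sigma> i) = orbit_rep \<sigma> i" using F by simp
  then have "i = orbit_rep \<sigma> i" by (rule orbit_rep_eq_fixed[OF \<sigma> finite_atLeastAtMost]) simp
  then show False using rF i by simp
qed

text \<open>Cauchy-Schwarz in every pair separates the slots. The bound then factorizes over the
  orbits, with the orbit size as exponent.\<close>

lemma abs_perm_sum_le_fibers:
  assumes \<sigma>: "\<sigma> permutes {1..2 * r}" and F: "F = {i\<in>{1..2 * r}. \<sigma> i = i}"
    and W: "W = orbit_rep \<sigma> ` {1..2 * r} - F"
  shows "\<bar>perm_sum B A f r \<sigma>\<bar> \<le> nrm (\<Sum>m\<in>A. f m) ^ card F *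
    (\<Prod>w\<in>W. \<Sum>m\<in>A. nrm (f m) ^ card {i\<in>{1..2 * r} - F. orbit_rep \<sigma> i = w})"
proof -
  let ?S = "\<Sum>m\<in>A. f m" and ?I = "{1..2 * r}"
  have sub: "orbit_rep \<sigma> ` (?I - F) \<subseteq> W"
    unfolding W using orbit_rep_nonfixed[OF \<sigma> F] by blast
  have "\<bar>perm_sum B A f r \<sigma>\<bar> \<le> (\<Sum>k\<in>W \<rightarrow>\<^sub>E A. \<bar>pair_prod B r (\<lambda>i. if i \<in> F then ?S else f (k (orbit_rep \<sigma> i)))\<bar>)"
    unfolding perm_sum_fixed_points[OF \<sigma> F W] by (rule sum_abs)
  also have "\<dots> \<le> (\<Sum>k\<in>W \<rightarrow>\<^sub>E A. nrm ?S ^ card F * (\<Prod>i\<in>?I - F. nrm (f (k (orbit_rep \<sigma> i)))))"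
  proof (rule sum_mono)
    fix k
    let ?g = "\<lambda>i. nrm (if i \<in> F then ?S else f (k (orbit_rep \<sigma> i)))"
    have "\<bar>pair_prod B r (\<lambda>i. if i \<in> F then ?S else f (k (orbit_rep \<sigma> i)))\<bar> \<le> prod ?g ?I"
      by (rule abs_pair_prod_le)
    also have "prod ?g ?I = prod ?g (?I - F) * prod ?g F"
      using F by (intro prod.subset_diff) auto
    also have "prod ?g F = nrm ?S ^ card F" by simp
    also have "prod ?g (?I - F) = (\<Prod>i\<in>?I - F. nrm (f (k (orbit_rep \<sigma> i))))" by simp
    finally show "\<bar>pair_prod B r (\<lambda>i. if i \<in> F then ?S else f (k (orbit_rep \<sigma> i)))\<bar>
        \<le> nrm ?S ^ card F * (\<Prod>i\<in>?I - F. nrm (f (k (orbit_rep \<sigma> i))))"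
      by (simp only: mult.commute)
  qed
  also have "\<dots> = nrm ?S ^ card F * (\<Prod>w\<in>W. \<Sum>m\<in>A. nrm (f m) ^ card {i\<in>?I - F. orbit_rep \<sigma> i = w})"
    unfolding sum_distrib_left[symmetric]
    using sub W finA by (subst sum_PiE_prod_fibers[where b = "\<lambda>m. nrm (f m)"]) auto
  finally show ?thesis .
qed

text \<open>The fibre is closed under \<sigma>, so it contains \<open>i\<close>,
  \<open>\<sigma> i\<close> and \<open>\<sigma> (\<sigma> i)\<close>.\<close>

lemma orbit_fiber_card_ge:
  assumes \<sigma>: "\<sigma> permutes {1..2 * r}" and F: "F = {i\<in>{1..2 * r}. \<sigma> i = i}" and i: "i \<in> {1..2 * r} - F"
  shows "2 \<le> card {j\<in>{1..2 * r} - F. orbit_rep \<sigma> j = orbit_rep \<sigma> i}"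
    and "\<sigma> (\<sigma> i) \<noteq> i \<Longrightarrow> 3 \<le> card {j\<in>{1..2 * r} - F. orbit_rep \<sigma> j = orbit_rep \<sigma> i}"
proof -
  let ?C = "{j\<in>{1..2 * r} - F. orbit_rep \<sigma> j = orbit_rep \<sigma> i}"
  note step = orbit_rep_step[OF \<sigma> finite_atLeastAtMost]
  have inj: "\<sigma> x = \<sigma> y \<longleftrightarrow> x = y" for x y using permutes_inj[OF \<sigma>] by (auto dest: injD)
  have mem: "\<sigma> x \<in> ?C" if "x \<in> ?C" for x
    using that permutes_in_image[OF \<sigma>] unfolding F by (simp add: step inj)
  have "i \<in> ?C" using i by simp
  then have C: "{i, \<sigma> i, \<sigma> (\<sigma> i)} \<subseteq> ?C" using mem by blast
  have ne: "\<sigma> i \<noteq> i" "\<sigma> (\<sigma> i) \<noteq> \<sigma> i" using i F inj by auto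
  have "card {i, \<sigma> i} \<le> card ?C" by (intro card_mono) (use C in auto)
  then show "2 \<le> card ?C" using ne by simp
  assume "\<sigma> (\<sigma> i) \<noteq> i"
  moreover have "card {i, \<sigma> i, \<sigma> (\<sigma> i)} \<le> card ?C" by (intro card_mono C) auto
  ultimately show "3 \<le> card ?C" using ne by (simp add: eval_nat_numeral)
qed

lemma sum_fiber_card:
  assumes \<sigma>: "\<sigma> permutes {1..2 * r}" and F: "F = {i\<in>{1..2 * r}. \<sigma> i = i}"
    and W: "W = orbit_rep \<sigma> ` {1..2 * r} - F"
  shows "(\<Sum>w\<in>W. card {i\<in>{1..2 * r} - F. orbit_rep \<sigma> i = w}) = 2 * r - card F"
proof -
  let ?I = "{1..2 * r}"
  have sub: "orbit_rep \<sigma> ` (?I - F) \<subseteq> W"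
    unfolding W using orbit_rep_nonfixed[OF \<sigma> F] by blast
  have "(\<Sum>w\<in>W. \<Sum>i\<in>{i\<in>?I - F. orbit_rep \<sigma> i = w}. (1::nat)) = (\<Sum>i\<in>?I - F. 1)"
    by (rule sum.group) (use W sub in auto)
  moreover have "card (?I - F) = 2 * r - card F" using F by (subst card_Diff_subset) auto
  ultimately show ?thesis by simp
qed

lemma fiber_rep:
  assumes \<sigma>: "\<sigma> permutes {1..2 * r}" and F: "F = {i\<in>{1..2 * r}. \<sigma> i = i}"
    and W: "w \<in> orbit_rep \<sigma> ` {1..2 * r} - F"
  obtains i where "i \<in> {1..2 * r} - F" "w = orbit_rep \<sigma> i"
proof -
  obtain i where i: "i \<in> {1..2 * r}" "w = orbit_rep \<sigma> i" "w \<notin> F" using W by auto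
  then have "i \<notin> F" using F orbit_rep_fixed[OF \<sigma> finite_atLeastAtMost] by auto
  then show ?thesis using that i by blast
qed

text \<open>Nontrivial orbits have at least two elements, so each contributes at most the power of
  \<open>square_fn B A f\<close> given by its size. These sizes add up to the number of nonfixed
  positions.\<close>

lemma abs_perm_sum_le_fixed:
  assumes \<sigma>: "\<sigma> permutes {1..2 * r}" and F: "F = {i\<in>{1..2 * r}. \<sigma> i = i}"
  shows "\<bar>perm_sum B A f r \<sigma>\<bar> \<le> nrm (\<Sum>m\<in>A. f m) ^ card F * square_fn B A f ^ (2 * r - card F)"
proof -
  define W where "W = orbit_rep \<sigma> ` {1..2 * r} - F"
  let ?c = "\<lambda>w. card {i\<in>{1..2 * r} - F. orbit_rep \<sigma> i = w}"
  have "(\<Prod>w\<in>W. \<Sum>m\<in>A. nrm (f m) ^ ?c w) \<le> (\<Prod>w\<in>W. square_fn B A f ^ ?c w)"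
  proof (rule prod_mono, safe)
    fix w assume "w \<in> W"
    then obtain i where i: "i \<in> {1..2 * r} - F" "w = orbit_rep \<sigma> i"
      using fiber_rep[OF \<sigma> F] unfolding W_def by blast
    show "(\<Sum>m\<in>A. nrm (f m) ^ ?c w) \<le> square_fn B A f ^ ?c w"
      unfolding square_fn_def i(2)
      using finA orbit_fiber_card_ge(1)[OF \<sigma> F i(1)] by (intro sum_power_le_sqrt_power) auto
    show "0 \<le> (\<Sum>m\<in>A. nrm (f m) ^ ?c w)" by (intro sum_nonneg) simp
  qed
  also have "\<dots> = square_fn B A f ^ (2 * r - card F)"
    by (simp only: power_sum[symmetric] sum_fiber_card[OF \<sigma> F W_def])
  finally show ?thesis
    using abs_perm_sum_le_fibers[OF \<sigma> F W_def] by (meson mult_left_mono nrm_nonneg order_trans zero_le_power)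
qed

text \<open>The orbit of \<open>i\<close> has at least three elements, which leaves room to estimate
  one of its factors by the maximum and still apply the l2 estimate to the others.\<close>

lemma abs_perm_sum_le_long_cycle:
  assumes \<sigma>: "\<sigma> permutes {1..2 * r}" and F: "{i\<in>{1..2 * r}. \<sigma> i = i} = {}"
    and i: "i \<in> {1..2 * r}" "\<sigma> (\<sigma> i) \<noteq> i"
  shows "\<bar>perm_sum B A f r \<sigma>\<bar> \<le> max_nrm B A f * square_fn B A f ^ (2 * r - 1)"
proof -
  \<comment> \<open>The form \<open>- {}\<close> matches the \<open>- F\<close> of the general
    lemmas at \<open>F = {}\<close>.\<close>
  define W where "W = orbit_rep \<sigma> ` {1..2 * r} - {}"
  note F' = F[symmetric]
  let ?c = "\<lambda>w. card {i\<in>{1..2 * r} - {}. orbit_rep \<sigma> i = w}"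
  let ?w = "orbit_rep \<sigma> i"
  have w: "?w \<in> W" "finite W" using i by (auto simp: W_def)
  have i': "i \<in> {1..2 * r} - {}" using i by simp
  define c where "c = ?c ?w - 1"
  have c3: "3 \<le> ?c ?w" by (rule orbit_fiber_card_ge(2)[OF \<sigma> F' i' i(2)])
  then have c: "?c ?w = Suc c" "2 \<le> c" unfolding c_def by linarith+
  have "(\<Sum>m\<in>A. nrm (f m) ^ ?c ?w) \<le> max_nrm B A f * square_fn B A f ^ c"
    unfolding c square_fn_def using finA nrm_le_max c(2)
    by (intro sum_power_le_bound_mult_sqrt_power) auto
  moreover have "(\<Prod>w\<in>W - {?w}. \<Sum>m\<in>A. nrm (f m) ^ ?c w) \<le> (\<Prod>w\<in>W - {?w}. square_fn B A f ^ ?c w)"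
  proof (rule prod_mono, safe)
    fix v assume "v \<in> W"
    then obtain j where j: "j \<in> {1..2 * r} - {}" "v = orbit_rep \<sigma> j"
      using fiber_rep[OF \<sigma> F'] unfolding W_def by blast
    show "(\<Sum>m\<in>A. nrm (f m) ^ ?c v) \<le> square_fn B A f ^ ?c v"
      unfolding square_fn_def j(2)
      using finA orbit_fiber_card_ge(1)[OF \<sigma> F' j(1)] by (intro sum_power_le_sqrt_power) auto
    show "0 \<le> (\<Sum>m\<in>A. nrm (f m) ^ ?c v)" by (intro sum_nonneg) simp
  qed
  ultimately have "(\<Prod>w\<in>W. \<Sum>m\<in>A. nrm (f m) ^ ?c w)
      \<le> max_nrm B A f * square_fn B A f ^ c * (\<Prod>w\<in>W - {?w}. square_fn B A f ^ ?c w)"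
    unfolding prod.remove[OF w(2,1)]
    by (rule mult_mono') (auto intro!: sum_nonneg prod_nonneg)
  also have "(\<Prod>w\<in>W - {?w}. square_fn B A f ^ ?c w) = square_fn B A f ^ (\<Sum>w\<in>W - {?w}. ?c w)"
    by (simp only: power_sum)
  also have "max_nrm B A f * square_fn B A f ^ c * square_fn B A f ^ (\<Sum>w\<in>W - {?w}. ?c w) = max_nrm B A f * square_fn B A f ^ (2 * r - 1)"
  proof -
    have "2 * r = ?c ?w + (\<Sum>w\<in>W - {?w}. ?c w)"
      using sum_fiber_card[OF \<sigma> F' W_def] by (simp only: sum.remove[OF w(2,1)] card.empty diff_zero)
    then have "2 * r - 1 = c + (\<Sum>w\<in>W - {?w}. ?c w)" using c by linarith
    then show ?thesis by (simp only: power_add mult.assoc)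
  qed
  finally show ?thesis
    using abs_perm_sum_le_fibers[OF \<sigma> F' W_def] by simp
qed

end
end

section \<open>Fixed-point free involutions\<close>

definition matchings :: "nat \<Rightarrow> (nat \<Rightarrow> nat) set" where
  "matchings r = {\<sigma>. \<sigma> permutes {1..2 * r} \<and> (\<forall>i\<in>{1..2 * r}. \<sigma> i \<noteq> i \<and> \<sigma> (\<sigma> i) = i)}"

text \<open>This matches the two slots of each factor, so that on invariant tuples every factor
  becomes some \<open>B (f m) (f m)\<close>.\<close>

definition std_matching :: "nat \<Rightarrow> nat \<Rightarrow> nat" where
  "std_matching r i = (if i \<in> {1..2 * r} then if odd i then i + 1 else i - 1 else i)"

context psd_form
begin

context
  fixes A :: "'b set" and f :: "'b \<Rightarrow> 'v" and r :: nat
  assumes finA: "finite A"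
begin

text \<open>The double sum is a diagonal value of \<open>B\<close>, at the linear combination with
  coefficients \<open>x\<close>.\<close>

lemma gram_psd: "0 \<le> (\<Sum>i\<in>A. \<Sum>j\<in>A. x i * B (f i) (f j) * x j)"
proof -
  have "B (\<Sum>i\<in>A. x i *\<^sub>R f i) (\<Sum>j\<in>A. x j *\<^sub>R f j) = (\<Sum>i\<in>A. \<Sum>j\<in>A. x i * B (f i) (f j) * x j)"
    by (simp only: sum_left) (simp add: sum_right bilinear_lmul[OF bilin] bilinear_rmul[OF bilin]
      sum_distrib_left mult_ac)
  then show ?thesis using nonneg by metis
qed

text \<open>The cycles of \<sigma> serve as vertices and the \<open>r\<close> pairs of slots as
  edges. Each cycle has two positions, so the graph is two-regular; its kernel is the Gram matrix of
  the family.\<close>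

lemma matching_perm_sum_nonneg:
  assumes "\<sigma> \<in> matchings r"
  shows "0 \<le> perm_sum B A f r \<sigma>"
proof -
  have \<sigma>: "\<sigma> permutes {1..2 * r}" and inv: "\<And>i. i \<in> {1..2 * r} \<Longrightarrow> \<sigma> i \<noteq> i \<and> \<sigma> (\<sigma> i) = i"
    using assms by (auto simp: matchings_def)
  let ?\<rho> = "orbit_rep \<sigma>" and ?I = "{1..2 * r}"
  let ?G = "\<lambda>a b. B (f a) (f b)"
  let ?W = "?\<rho> ` ?I"
  \<comment> \<open>The label 0 stands for the first power of the kernel.\<close>
  define es where "es = image_mset (\<lambda>i. (?\<rho> (2 * i - 1), ?\<rho> (2 * i), 0::nat)) (mset_set {1..r})"
  have prod: "pair_prod B r (\<lambda>i. f (k (?\<rho> i))) = (\<Prod>e\<in>#es. edge_val ?G A k e)" for k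
    by (simp add: pair_prod_def es_def prod_unfold_prod_mset multiset.map_comp comp_def)
  \<comment> \<open>General \<open>s\<close> is for the induction; the case \<open>s = r\<close> is
    used.\<close>
  have ends: "(\<Sum>\<^sub># (image_mset edge_ends (image_mset (\<lambda>i. (?\<rho> (2 * i - 1), ?\<rho> (2 * i), 0::nat)) (mset_set {1..s}))))
      = image_mset ?\<rho> (mset_set {1..2 * s})" for s
    by (induction s) (simp_all add: atLeastAtMostSuc_conv)
  have "image_mset ?\<rho> (mset_set ?I) = mset_set ?W + mset_set ?W"
  proof (rule multiset_eqI)
    fix w
    have "count (image_mset ?\<rho> (mset_set ?I)) w = card {i\<in>?I. ?\<rho> i = w}"
    proof -
      have "{i\<in>?I. ?\<rho> i = w} = ?\<rho> -` {w} \<inter> ?I" by auto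
      then show ?thesis by (simp add: count_image_mset)
    qed
    also have "\<dots> = count (mset_set ?W + mset_set ?W) w"
    proof (cases "w \<in> ?W")
      case True
      then obtain i where i: "i \<in> ?I" "w = ?\<rho> i" by blast
      have "\<sigma> i \<in> ?I" using i permutes_in_image[OF \<sigma>] by blast
      then have "{j\<in>?I. ?\<rho> j = w} = {i, \<sigma> i}"
        using i inv orbit_rep_involution[OF \<sigma> finite_atLeastAtMost, of i]
          orbit_rep_step[OF \<sigma> finite_atLeastAtMost, of i] by blast
      then show ?thesis using True inv[OF i(1)] by simp
    next
      case False
      then have "{j\<in>?I. ?\<rho> j = w} = {}" by blast
      then show ?thesis using False by (simp only: card.empty count_union) simp
    qed
    finally show "count (image_mset ?\<rho> (mset_set ?I)) w = count (mset_set ?W + mset_set ?W) w" .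
  qed
  then have E: "\<Sum>\<^sub># (image_mset edge_ends es) = mset_set ?W + mset_set ?W"
    unfolding es_def ends .
  have "0 \<le> (\<Sum>k\<in>?W \<rightarrow>\<^sub>E A. \<Prod>e\<in>#es. edge_val ?G A k e)"
  proof (rule two_regular_sum_nonneg[OF finA _ _ _ E])
    show "0 \<le> (\<Sum>i\<in>A. \<Sum>j\<in>A. x i * B (f i) (f j) * x j)" for x by (rule gram_psd)
    show "B (f i) (f j) = B (f j) (f i)" for i j by (rule sym)
  qed simp
  then show ?thesis unfolding perm_sum_orbit_rep[OF finA \<sigma>] prod .
qed

lemma matching_sign:
  assumes "\<sigma> \<in> matchings r"
  shows "sign \<sigma> = (-1) ^ r"
proof (rule sign_fixpoint_free_involution)
  show \<sigma>: "\<sigma> permutes {1..2 * r}" using assms by (simp add: matchings_def)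
  show "\<sigma> (\<sigma> i) = i" for i
    using assms permutes_not_in[OF \<sigma>] by (cases "i \<in> {1..2 * r}") (simp_all add: matchings_def)
qed (use assms in \<open>auto simp: matchings_def\<close>)

lemma std_matching_in_matchings: "std_matching r \<in> matchings r"
proof -
  have mem: "std_matching r i \<in> {1..2 * r}" if "i \<in> {1..2 * r}" for i
    using that unfolding std_matching_def by auto presburger+
  have inv: "std_matching r (std_matching r i) = i" for i
    using mem[of i] unfolding std_matching_def by (auto split: if_splits)
  have "bij_betw (std_matching r) {1..2 * r} {1..2 * r}"
    by (rule bij_betw_byWitness[where f' = "std_matching r"]) (use mem inv in auto)
  then have "std_matching r permutes {1..2 * r}"
    by (rule bij_imp_permutes) (simp only: std_matching_def if_False)
  moreover have "std_matching r i \<noteq> i" if "i \<in> {1..2 * r}" for i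
    using that unfolding std_matching_def by auto
  ultimately show ?thesis using inv by (simp add: matchings_def)
qed

lemma perm_sum_std_matching: "perm_sum B A f r (std_matching r) = (\<Sum>m\<in>A. B (f m) (f m)) ^ r"
proof -
  \<comment> \<open>In place of \<open>orbit_rep\<close>, this explicit map sends each pair to its
    odd position. With representatives of the form \<open>2 * i - 1\<close> the sum visibly
    factorizes over the pairs.\<close>
  define \<rho> :: "nat \<Rightarrow> nat" where "\<rho> i = (if even i then i - 1 else i)" for i
  let ?I = "{1..2 * r}"
  have inv: "(\<forall>i\<in>?I. l (std_matching r i) = l i) \<longleftrightarrow> (\<forall>i\<in>?I. l (\<rho> i) = l i)" for l :: "nat \<Rightarrow> 'b"
  proof
    assume h: "\<forall>i\<in>?I. l (std_matching r i) = l i"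
    then show "\<forall>i\<in>?I. l (\<rho> i) = l i" by (auto simp: std_matching_def \<rho>_def)
  next
    assume h: "\<forall>i\<in>?I. l (\<rho> i) = l i"
    show "\<forall>i\<in>?I. l (std_matching r i) = l i"
    proof
      fix i assume i: "i \<in> ?I"
      show "l (std_matching r i) = l i"
      proof (cases "even i")
        case True
        then have "std_matching r i = \<rho> i" using i unfolding std_matching_def \<rho>_def by simp
        then show ?thesis using h i by simp
      next
        case False
        then have "i + 1 \<in> ?I" using i by auto presburger
        then have "l (\<rho> (i + 1)) = l (i + 1)" using h by blast
        then show ?thesis using i False by (simp add: std_matching_def \<rho>_def)
      qed
    qed
  qed
  have img: "\<rho> ` ?I = (\<lambda>i. 2 * i - 1) ` {1..r}"
  proof (intro set_eqI iffI)
    fix x assume "x \<in> \<rho> ` ?I"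
    then obtain i where i: "i \<in> ?I" "x = \<rho> i" by blast
    then have "x = 2 * ((i + 1) div 2) - 1" "(i + 1) div 2 \<in> {1..r}"
      by (auto simp: \<rho>_def)
    then show "x \<in> (\<lambda>i. 2 * i - 1) ` {1..r}" by blast
  next
    fix x assume "x \<in> (\<lambda>i. 2 * i - 1) ` {1..r}"
    then obtain i where "i \<in> {1..r}" "x = 2 * i - 1" by blast
    then have "x = \<rho> (2 * i)" "2 * i \<in> ?I" by (auto simp: \<rho>_def)
    then show "x \<in> \<rho> ` ?I" by blast
  qed
  have inj: "inj_on (\<lambda>i. 2 * i - 1 :: nat) {1..r}" by (auto simp: inj_on_def)
  have "perm_sum B A f r (std_matching r) = (\<Sum>k\<in>\<rho> ` ?I \<rightarrow>\<^sub>E A. pair_prod B r (\<lambda>i. f (k (\<rho> i))))"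
    unfolding perm_sum_def inv
  proof (rule sum_invariant_reindex)
    show "pair_prod B r (\<lambda>i. f (l i)) = pair_prod B r (\<lambda>i. f (l' i))"
      if "\<And>i. i \<in> {1..2 * r} \<Longrightarrow> l i = l' i" for l l'
      using that by (intro pair_prod_cong) simp
    show "\<rho> i \<in> ?I" if "i \<in> ?I" for i using that by (auto simp: \<rho>_def)
    show "\<rho> (\<rho> i) = \<rho> i" if "i \<in> ?I" for i using that by (auto simp: \<rho>_def)
  qed
  also have "\<dots> = (\<Sum>k\<in>\<rho> ` ?I \<rightarrow>\<^sub>E A. \<Prod>w\<in>\<rho> ` ?I. B (f (k w)) (f (k w)))"
  proof (rule sum.cong)
    fix k
    have "pair_prod B r (\<lambda>i. f (k (\<rho> i))) = (\<Prod>i = 1..r. B (f (k (2 * i - 1))) (f (k (2 * i - 1))))"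
      unfolding pair_prod_def by (intro prod.cong refl) (auto simp: \<rho>_def)
    then show "pair_prod B r (\<lambda>i. f (k (\<rho> i))) = (\<Prod>w\<in>\<rho> ` ?I. B (f (k w)) (f (k w)))"
      unfolding img prod.reindex[OF inj] comp_def .
  qed simp
  also have "\<dots> = (\<Prod>w\<in>\<rho> ` ?I. \<Sum>m\<in>A. B (f m) (f m))"
    using finA by (subst prod_sum_PiE) auto
  also have "card (\<rho> ` ?I) = r" unfolding img card_image[OF inj] by simp
  then have "(\<Prod>w\<in>\<rho> ` ?I. \<Sum>m\<in>A. B (f m) (f m)) = (\<Sum>m\<in>A. B (f m) (f m)) ^ r" by simp
  finally show ?thesis .
qed

section \<open>The pointwise inequality\<close>

lemma square_fn_power: "square_fn B A f ^ (2 * r) = (\<Sum>m\<in>A. B (f m) (f m)) ^ r"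
  by (simp add: square_fn_def power_mult sum_nonneg)

lemma nrm_power: "nrm v ^ (2 * r) = B v v ^ r"
  by (simp add: power_mult)

text \<open>A permutation that is not a matching has a fixed point or, failing that, a cycle of
  length at least three. Either bound has a factor other than \<open>square_fn\<close>, to which the
  weighted inequality applies. The parameter \<open>c\<close> is fixed only once the number of
  permutations enters.\<close>

lemma abs_perm_sum_absorb:
  assumes neA: "A \<noteq> {}" and r: "r \<ge> 1" and c: "1 \<le> c" and \<sigma>: "\<sigma> permutes {1..2 * r}" and nm: "\<sigma> \<notin> matchings r"
  shows "\<bar>perm_sum B A f r \<sigma>\<bar> \<le> (\<Sum>m\<in>A. B (f m) (f m)) ^ r / c
    + c ^ (2 * r - 1) * (B (\<Sum>m\<in>A. f m) (\<Sum>m\<in>A. f m) ^ r + (\<Sum>m\<in>A. B (f m) (f m) ^ r))"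
proof -
  let ?S = "\<Sum>m\<in>A. f m" and ?Q = "square_fn B A f" and ?R = "max_nrm B A f"
  define F where "F = {i\<in>{1..2 * r}. \<sigma> i = i}"
  have Q: "0 \<le> ?Q" by (rule square_fn_nonneg[OF finA])
  have R: "0 \<le> ?R" using nrm_le_max[OF finA] neA nrm_nonneg by (metis all_not_in_conv order_trans)
  have RN: "?R ^ (2 * r) \<le> (\<Sum>m\<in>A. B (f m) (f m) ^ r)"
    using max_nrm_power_le[OF finA neA, of f "2 * r"] by (simp only: nrm_power)
  have SN: "0 \<le> B ?S ?S ^ r" by simp
  have TN: "0 \<le> (\<Sum>m\<in>A. B (f m) (f m) ^ r)" by (simp add: sum_nonneg)
  show ?thesis
  proof (cases "F = {}")
    case False
    have fin: "finite F" by (simp add: F_def)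
    have "1 \<le> card F" using False fin by (simp add: Suc_le_eq card_gt_0_iff)
    moreover have "card F \<le> 2 * r"
    proof -
      have "card F \<le> card {1..2 * r}" by (intro card_mono) (auto simp: F_def)
      then show ?thesis by simp
    qed
    ultimately have "nrm ?S ^ card F * ?Q ^ (2 * r - card F) \<le> ?Q ^ (2 * r) / c + c ^ (2 * r - 1) * nrm ?S ^ (2 * r)"
      using Q c by (intro weighted_power_absorb) auto
    then have "\<bar>perm_sum B A f r \<sigma>\<bar> \<le> ?Q ^ (2 * r) / c + c ^ (2 * r - 1) * nrm ?S ^ (2 * r)"
      using abs_perm_sum_le_fixed[OF finA \<sigma> F_def, of f] by linarith
    also have "\<dots> \<le> ?Q ^ (2 * r) / c + c ^ (2 * r - 1) * (nrm ?S ^ (2 * r) + (\<Sum>m\<in>A. B (f m) (f m) ^ r))"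
      using c TN by (intro add_left_mono mult_left_mono) auto
    finally show ?thesis by (simp only: square_fn_power nrm_power)
  next
    case True
    then obtain i where i: "i \<in> {1..2 * r}" "\<sigma> (\<sigma> i) \<noteq> i"
      using nm \<sigma> unfolding matchings_def F_def by blast
    have "?R ^ 1 * ?Q ^ (2 * r - 1) \<le> ?Q ^ (2 * r) / c + c ^ (2 * r - 1) * ?R ^ (2 * r)"
      using Q R c r by (intro weighted_power_absorb) auto
    then have "\<bar>perm_sum B A f r \<sigma>\<bar> \<le> ?Q ^ (2 * r) / c + c ^ (2 * r - 1) * ?R ^ (2 * r)"
      using abs_perm_sum_le_long_cycle[OF finA \<sigma> _ i, of f] True unfolding F_def by simp
    also have "\<dots> \<le> ?Q ^ (2 * r) / c + c ^ (2 * r - 1) * (B ?S ?S ^ r + (\<Sum>m\<in>A. B (f m) (f m) ^ r))"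
      using c RN SN by (intro add_left_mono mult_left_mono add_increasing) auto
    finally show ?thesis by (simp only: square_fn_power)
  qed
qed

text \<open>All matchings carry the sign \<open>(-1) ^ r\<close>, so the signed expansion can be
  solved for their sum; the other permutations are error terms. The sum over distinct tuples keeps
  its sign here, because only its integral is known to vanish.\<close>

lemma square_fn_pointwise:
  assumes neA: "A \<noteq> {}" and r: "r \<ge> 1"
  shows "(\<Sum>m\<in>A. B (f m) (f m)) ^ r \<le>
    2 * (-1) ^ r * (\<Sum>l | l \<in> {1..2 * r} \<rightarrow>\<^sub>E A \<and> inj_on l {1..2 * r}. pair_prod B r (\<lambda>i. f (l i)))
    + (2 * fact (2 * r)) ^ (2 * r) * (B (\<Sum>m\<in>A. f m) (\<Sum>m\<in>A. f m) ^ r + (\<Sum>m\<in>A. B (f m) (f m) ^ r))"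
    (is "?Q \<le> 2 * (-1) ^ r * ?D + _ * ?Y")
proof -
  let ?T = "perm_sum B A f r" and ?P = "{\<sigma>. \<sigma> permutes {1..2 * r}}"
  define K :: real where "K = fact (2 * r)"
  have K: "1 \<le> K" unfolding K_def by (rule fact_ge_1)
  have finP: "finite ?P" by (simp add: finite_permutations)
  have MP: "matchings r \<subseteq> ?P" by (auto simp: matchings_def)
  have finM: "finite (matchings r)" using MP finP by (rule finite_subset)
  have Y: "0 \<le> ?Y" by (simp add: sum_nonneg)
  have Q: "0 \<le> ?Q" by (simp add: sum_nonneg)
  \<comment> \<open>The standard matching alone contributes \<open>?Q\<close>, and the other
    matchings contribute nonnegative terms.\<close>
  have "?Q \<le> sum ?T (matchings r)"
    unfolding perm_sum_std_matching[symmetric]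
    by (rule member_le_sum) (use std_matching_in_matchings matching_perm_sum_nonneg finM in auto)
  also have "sum ?T (matchings r) = (-1) ^ r * (\<Sum>\<sigma>\<in>matchings r. of_int (sign \<sigma>) * ?T \<sigma>)"
    by (simp add: matching_sign sum_distrib_left flip: mult.assoc power_add)
  also have "(\<Sum>\<sigma>\<in>matchings r. of_int (sign \<sigma>) * ?T \<sigma>) = ?D - (\<Sum>\<sigma>\<in>?P - matchings r. of_int (sign \<sigma>) * ?T \<sigma>)"
  proof -
    have "?D = (\<Sum>\<sigma>\<in>?P. of_int (sign \<sigma>) * ?T \<sigma>)"
      unfolding perm_sum_def by (rule sum_inj_eq_signed_sum) (use finA in auto)
    then show ?thesis unfolding sum.subset_diff[OF MP finP] by linarith
  qed
  also have "(-1) ^ r * (?D - (\<Sum>\<sigma>\<in>?P - matchings r. of_int (sign \<sigma>) * ?T \<sigma>))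
      \<le> (-1) ^ r * ?D + \<bar>\<Sum>\<sigma>\<in>?P - matchings r. of_int (sign \<sigma>) * ?T \<sigma>\<bar>"
    by (cases "even r") auto
  also have "\<bar>\<Sum>\<sigma>\<in>?P - matchings r. of_int (sign \<sigma>) * ?T \<sigma>\<bar> \<le> (\<Sum>\<sigma>\<in>?P - matchings r. \<bar>?T \<sigma>\<bar>)"
    by (rule order_trans[OF sum_abs]) (simp add: abs_mult flip: of_int_abs)
  \<comment> \<open>There are at most \<open>K\<close> error terms, so \<open>c = 2 * K\<close>
    limits their total share of \<open>?Q\<close> to one half. Moving that half to the left produces
    the factor 2 in front of \<open>?D\<close>.\<close>
  also have "\<dots> \<le> (\<Sum>\<sigma>\<in>?P - matchings r. ?Q / (2 * K) + (2 * K) ^ (2 * r - 1) * ?Y)"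
    using K r neA by (intro sum_mono abs_perm_sum_absorb) auto
  also have "\<dots> \<le> (\<Sum>\<sigma>\<in>?P. ?Q / (2 * K) + (2 * K) ^ (2 * r - 1) * ?Y)"
    using K Q Y finP by (intro sum_mono2) auto
  also have "\<dots> = K * (?Q / (2 * K) + (2 * K) ^ (2 * r - 1) * ?Y)"
    by (simp add: card_permutations[of _ "2 * r"] K_def)
  also have "\<dots> = ?Q / 2 + (2 * K) ^ (2 * r) * ?Y / 2"
  proof -
    have "(2 * K) ^ (2 * r) = (2 * K) * (2 * K) ^ (2 * r - 1)"
    proof -
      have "Suc (2 * r - 1) = 2 * r" using r by simp
      then show ?thesis by (metis power_Suc)
    qed
    then show ?thesis using K by (simp add: distrib_left)
  qed
  finally show ?thesis unfolding K_def by simp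
qed

end
end

section \<open>Symmetrization and integration\<close>

definition sym_part :: "('v \<Rightarrow> 'v \<Rightarrow> complex) \<Rightarrow> 'v \<Rightarrow> 'v \<Rightarrow> real" where
  "sym_part B v w = Re (B v w + B w v) / 2"

lemma sym_part_diag: "sym_part B v v = Re (B v v)"
  by (simp add: sym_part_def)

text \<open>Polarization expresses \<open>B v w + B w v\<close> by diagonal values, which are real,
  so the real part in \<open>sym_part\<close> loses nothing.\<close>

lemma of_real_sym_part:
  assumes "positive_form B"
  shows "complex_of_real (sym_part B v w) = (B v w + B w v) / 2"
proof -
  have bil: "bilinear B" and real: "B u u \<in> \<real>" for u using assms by (auto simp: positive_form_def)
  have "B v w + B w v = B (v + w) (v + w) - B v v - B w w"
    using bil by (simp add: bilinear_ladd bilinear_radd)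
  then have "B v w + B w v \<in> \<real>" using real by (metis Reals_diff)
  then show ?thesis by (simp add: sym_part_def of_real_Re del: plus_complex.sel)
qed

lemma psd_form_sym_part:
  assumes "positive_form B"
  shows "psd_form (sym_part B)"
proof
  have bil: "bilinear B" using assms by (simp add: positive_form_def)
  show "bilinear (sym_part B)"
    unfolding bilinear_def sym_part_def
    by (auto intro!: linearI simp: bilinear_ladd[OF bil] bilinear_radd[OF bil]
        bilinear_lmul[OF bil] bilinear_rmul[OF bil] field_simps)
  show "sym_part B v w = sym_part B w v" for v w by (simp add: sym_part_def add.commute)
  show "0 \<le> sym_part B v v" for v using assms by (simp add: sym_part_diag positive_form_def)
qed

section \<open>Expansion of the symmetrized product\<close>

definition pair_swap :: "nat set \<Rightarrow> nat \<Rightarrow> nat" where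
  "pair_swap X j = (if (j + 1) div 2 \<in> X then j else if odd j then j + 1 else j - 1)"

lemma pair_swap_mem: "j \<in> {1..2 * r} \<Longrightarrow> pair_swap X j \<in> {1..2 * r}"
  unfolding pair_swap_def by auto presburger+

lemma inj_on_pair_swap: "inj_on (pair_swap X) {1..2 * r}"
proof -
  have "pair_swap X (pair_swap X j) = j" if j1: "j \<ge> 1" for j
  proof (cases "even j")
    case True
    then obtain i where "j = 2 * Suc i" using j1 by (cases j) (auto elim!: oddE)
    then show ?thesis by (auto simp: pair_swap_def)
  next
    case False
    then obtain i where "j = 2 * i + 1" using oddE by blast
    then show ?thesis by (auto simp: pair_swap_def)
  qed
  then show ?thesis by (intro inj_on_inverseI[where g = "pair_swap X"]) auto
qed

text \<open>Expanding the product of sums chooses an order in each pair: \<open>X\<close> is the set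
  of pairs whose order is kept, and \<open>pair_swap X\<close> reverses the others. Thus the
  symmetrized product is an average of the original products over reorderings of one tuple.\<close>

lemma pair_prod_sym_part:
  assumes "positive_form B"
  shows "complex_of_real (pair_prod (sym_part B) r (\<lambda>i. f (l i) x))
    = (\<Sum>X\<in>Pow {1..r}. form_prod B f r (\<lambda>j. l (pair_swap X j)) x) / 2 ^ r"
proof -
  let ?b = "\<lambda>i. B (f (l (2 * i - 1)) x) (f (l (2 * i)) x)"
  let ?c = "\<lambda>i. B (f (l (2 * i)) x) (f (l (2 * i - 1)) x)"
  have swap: "form_prod B f r (\<lambda>j. l (pair_swap X j)) x = prod ?b X * prod ?c ({1..r} - X)"
    if "X \<subseteq> {1..r}" for X
  proof -
    have div: "(2 * i - 1 + 1) div 2 = i" if "i \<ge> 1" for i :: nat using that by simp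
    have "form_prod B f r (\<lambda>j. l (pair_swap X j)) x
        = (\<Prod>i\<in>{1..r}. if i \<in> X then ?b i else ?c i)"
      unfolding form_prod_def by (intro prod.cong refl) (auto simp: pair_swap_def)
    also have "\<dots> = (\<Prod>i\<in>{1..r} - X. if i \<in> X then ?b i else ?c i) * (\<Prod>i\<in>X. if i \<in> X then ?b i else ?c i)"
      using that by (intro prod.subset_diff) auto
    also have "\<dots> = prod ?c ({1..r} - X) * prod ?b X" by simp
    finally show ?thesis by (simp only: mult.commute)
  qed
  have "complex_of_real (pair_prod (sym_part B) r (\<lambda>i. f (l i) x)) = (\<Prod>i\<in>{1..r}. (?b i + ?c i) / 2)"
    by (simp add: pair_prod_def of_real_sym_part[OF assms])
  also have "\<dots> = (\<Prod>i\<in>{1..r}. ?b i + ?c i) / 2 ^ r" by (simp add: prod_dividef)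
  also have "(\<Prod>i\<in>{1..r}. ?b i + ?c i) = (\<Sum>X\<in>Pow {1..r}. prod ?b X * prod ?c ({1..r} - X))"
    by (rule prod_add) simp
  also have "\<dots> = (\<Sum>X\<in>Pow {1..r}. form_prod B f r (\<lambda>j. l (pair_swap X j)) x)"
    by (intro sum.cong refl) (simp add: swap)
  finally show ?thesis .
qed

lemma Lp_norm_even:
  assumes "r \<ge> 1"
  shows "Lp_norm M (2 * real r) g = (\<integral>x. g x ^ (2 * r) \<partial>M) powr (1 / (2 * real r))"
proof -
  have "\<bar>g x\<bar> powr (2 * real r) = g x ^ (2 * r)" for x
    using powr_realpow'[of "\<bar>g x\<bar>" "2 * r"] assms by (simp add: power_even_abs)
  then show ?thesis by (simp add: Lp_norm_def)
qed

lemma powr_inverse_power: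
  fixes u :: real
  assumes "0 \<le> u" "n \<ge> 1"
  shows "(u powr (1 / real n)) ^ n = u"
  using powr_realpow'[of "u powr (1 / real n)" n] assms by (simp add: powr_powr)

text \<open>All positions are fixed, so no index remains. Read from right to left, this writes the
  power of \<open>B\<close> at the sum as a finite sum of products, from which its integrability
  will follow.\<close>

lemma (in psd_form) perm_sum_id:
  assumes "finite A"
  shows "perm_sum B A f r id = B (\<Sum>m\<in>A. f m) (\<Sum>m\<in>A. f m) ^ r"
proof -
  let ?S = "\<Sum>m\<in>A. f m"
  have F: "{1..2 * r} = {i \<in> {1..2 * r}. id i = i}" by auto
  have W: "{} = orbit_rep id ` {1..2 * r} - {1..2 * r}"
    using orbit_rep_fixed[of id "{1..2 * r}"] by (auto simp: permutes_id)
  \<comment> \<open>The only tuple on the empty set is constantly \<open>undefined\<close>; it is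
    evaluated only at positions outside the product.\<close>
  have "perm_sum B A f r id = pair_prod B r (\<lambda>i. if i \<in> {1..2 * r} then ?S else f undefined)"
    unfolding perm_sum_fixed_points[OF assms permutes_id F W, of f] PiE_empty_domain by simp
  also have "\<dots> = pair_prod B r (\<lambda>i. ?S)" by (rule pair_prod_cong) simp
  also have "\<dots> = B ?S ?S ^ r" by (simp add: pair_prod_def)
  finally show ?thesis .
qed

section \<open>Integration of the pointwise inequality\<close>

context
  fixes M :: "'a measure" and B :: "'v::real_vector \<Rightarrow> 'v \<Rightarrow> complex" and r L :: nat
    and f :: "nat \<Rightarrow> 'a \<Rightarrow> 'v"
  assumes pos: "positive_form B"
    and int: "\<And>l. l \<in> {1..2 * r} \<rightarrow> {1..L} \<Longrightarrow> integrable M (form_prod B f r l)"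
begin

lemma pair_prod_sym_part_Re:
  "pair_prod (sym_part B) r (\<lambda>i. f (l i) x)
    = (\<Sum>X\<in>Pow {1..r}. Re (form_prod B f r (\<lambda>j. l (pair_swap X j)) x)) / 2 ^ r"
proof -
  have "pair_prod (sym_part B) r (\<lambda>i. f (l i) x)
      = Re ((\<Sum>X\<in>Pow {1..r}. form_prod B f r (\<lambda>j. l (pair_swap X j)) x) / complex_of_real (2 ^ r))"
    using pair_prod_sym_part[OF pos, of r f l x] by (metis Re_complex_of_real of_real_numeral of_real_power)
  then show ?thesis by (simp only: Re_divide_of_real Re_sum)
qed

lemma int_swap:
  assumes "l \<in> {1..2 * r} \<rightarrow> {1..L}"
  shows "integrable M (form_prod B f r (\<lambda>j. l (pair_swap X j)))"
  by (rule int) (use assms pair_swap_mem in blast)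

lemma integrable_pair_prod:
  assumes "l \<in> {1..2 * r} \<rightarrow> {1..L}"
  shows "integrable M (\<lambda>x. pair_prod (sym_part B) r (\<lambda>i. f (l i) x))"
  unfolding pair_prod_sym_part_Re
  by (intro integrable_divide Bochner_Integration.integrable_sum integrable_Re int_swap assms)

text \<open>Reversing the order inside pairs permutes the entries of a tuple. Distinctness is
  preserved, so each term of the expansion integrates to zero.\<close>

lemma integral_pair_prod_zero:
  assumes l: "l \<in> {1..2 * r} \<rightarrow> {1..L}" "inj_on l {1..2 * r}"
    and zero: "\<And>l. l \<in> {1..2 * r} \<rightarrow> {1..L} \<Longrightarrow> inj_on l {1..2 * r} \<Longrightarrow> (\<integral>x. form_prod B f r l x \<partial>M) = 0"
  shows "(\<integral>x. pair_prod (sym_part B) r (\<lambda>i. f (l i) x) \<partial>M) = 0"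
proof -
  have "(\<integral>x. form_prod B f r (\<lambda>j. l (pair_swap X j)) x \<partial>M) = 0" for X
  proof (rule zero)
    show "(\<lambda>j. l (pair_swap X j)) \<in> {1..2 * r} \<rightarrow> {1..L}" using l(1) pair_swap_mem by blast
    have "inj_on (l \<circ> pair_swap X) {1..2 * r}"
      by (intro comp_inj_on inj_on_pair_swap inj_on_subset[OF l(2)]) (use pair_swap_mem in blast)
    then show "inj_on (\<lambda>j. l (pair_swap X j)) {1..2 * r}" by (simp add: comp_def)
  qed
  then show ?thesis
    unfolding pair_prod_sym_part_Re
    by (subst integral_divide_zero, subst Bochner_Integration.integral_sum)
       (auto intro!: integrable_Re int_swap l simp: int_swap[OF l(1)])
qed

text \<open>At the identity and at \<open>std_matching\<close> this gives integrability of the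
  \<open>2 * r\<close>-th powers of the seminorm of the sum and of the square function.\<close>

lemma integrable_perm_sum: "integrable M (\<lambda>x. perm_sum (sym_part B) {1..L} (\<lambda>m. f m x) r \<sigma>)"
  unfolding perm_sum_def by (intro Bochner_Integration.integrable_sum integrable_pair_prod) auto

lemma integral_square_fn_le:
  assumes r: "r \<ge> 1" and L: "L \<ge> 1"
    and zero: "\<And>l. l \<in> {1..2 * r} \<rightarrow> {1..L} \<Longrightarrow> inj_on l {1..2 * r} \<Longrightarrow> (\<integral>x. form_prod B f r l x \<partial>M) = 0"
  shows "(\<integral>x. (\<Sum>m = 1..L. Re (B (f m x) (f m x))) ^ r \<partial>M) \<le> (2 * fact (2 * r)) ^ (2 * r) *
    ((\<integral>x. Re (B (\<Sum>m = 1..L. f m x) (\<Sum>m = 1..L. f m x)) ^ r \<partial>M)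
      + (\<integral>x. (\<Sum>m = 1..L. Re (B (f m x) (f m x)) ^ r) \<partial>M))"
proof -
  interpret psd_form "sym_part B" by (rule psd_form_sym_part[OF pos])
  have fin: "finite {1..L}" and ne: "{1..L} \<noteq> {}" using L by auto
  let ?b = "sym_part B" and ?c = "(2 * fact (2 * r)) ^ (2 * r) :: real"
  define S where "S x = ?b (\<Sum>m = 1..L. f m x) (\<Sum>m = 1..L. f m x) ^ r" for x
  define R where "R x = (\<Sum>m = 1..L. ?b (f m x) (f m x) ^ r)" for x
  define Q where "Q x = (\<Sum>m = 1..L. ?b (f m x) (f m x)) ^ r" for x
  define D where "D x = (\<Sum>l | l \<in> {1..2 * r} \<rightarrow>\<^sub>E {1..L} \<and> inj_on l {1..2 * r}.
    pair_prod ?b r (\<lambda>i. f (l i) x))" for x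
  have iS: "integrable M S"
    using integrable_perm_sum[of id] unfolding perm_sum_id[OF fin] S_def .
  have iQ: "integrable M Q"
    using integrable_perm_sum[of "std_matching r"] unfolding perm_sum_std_matching[OF fin] Q_def .
  have iR: "integrable M R"
  proof -
    have "integrable M (\<lambda>x. ?b (f m x) (f m x) ^ r)" if "m \<in> {1..L}" for m
      \<comment> \<open>A constant tuple turns the product into a power of one diagonal
        value.\<close>
      using integrable_pair_prod[of "\<lambda>_. m"] that by (simp add: pair_prod_def)
    then show ?thesis unfolding R_def by (intro Bochner_Integration.integrable_sum) auto
  qed
  have iD: "integrable M D"
    unfolding D_def by (intro Bochner_Integration.integrable_sum integrable_pair_prod) auto
  have D0: "(\<integral>x. D x \<partial>M) = 0"
    unfolding D_def
    by (subst Bochner_Integration.integral_sum)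
       (auto intro!: integrable_pair_prod sum.neutral integral_pair_prod_zero zero)
  have "(\<integral>x. Q x \<partial>M) \<le> (\<integral>x. 2 * (-1) ^ r * D x + ?c * (S x + R x) \<partial>M)"
  proof (rule integral_mono)
    show "Q x \<le> 2 * (-1) ^ r * D x + ?c * (S x + R x)" for x
      using square_fn_pointwise[OF fin ne r, of "\<lambda>m. f m x"] unfolding Q_def D_def S_def R_def .
  qed (use iQ iD iS iR in auto)
  also have "\<dots> = ?c * ((\<integral>x. S x \<partial>M) + (\<integral>x. R x \<partial>M))"
    using iD iS iR D0 by simp
  finally show ?thesis by (simp only: Q_def S_def R_def sym_part_diag)
qed

end

section \<open>Passage to norms and the final constant\<close>

lemma one_plus_power_le:
  fixes a :: real
  assumes "0 \<le> a" "1 \<le> n"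
  shows "1 + a ^ n \<le> (1 + a) ^ n"
  using assms(2)
proof (induction n rule: dec_induct)
  case (step n)
  have "1 + a ^ Suc n \<le> (1 + a) * (1 + a ^ n)" using assms(1) by (simp add: algebra_simps)
  also have "\<dots> \<le> (1 + a) * (1 + a) ^ n" using step assms(1) by (intro mult_left_mono) auto
  finally show ?case by simp
qed simp

theorem theorem2:
  fixes r :: nat and A :: real
  assumes "r \<ge> 1" and "A > 0"
  shows "\<exists>C>0. C \<le> const_bound r A \<and>
    (\<forall>(M :: 'a measure) (B :: 'v::real_vector \<Rightarrow> 'v \<Rightarrow> complex) (L :: nat) (f :: nat \<Rightarrow> 'a \<Rightarrow> 'v).
       sigma_finite_measure M \<longrightarrow>
       positive_form B \<longrightarrow>
       L \<ge> 1 \<longrightarrow>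
       (\<forall>l \<in> {1..2 * r} \<rightarrow> {1..L}. integrable M (form_prod B f r l)) \<longrightarrow>
       (\<forall>l \<in> {1..2 * r} \<rightarrow> {1..L}. inj_on l {1..2 * r} \<longrightarrow>
          (\<integral>x. form_prod B f r l x \<partial>M) = 0) \<longrightarrow>
       Lp_norm M (2 * real r)
           (\<lambda>x. (\<Sum>l = 1..L. form_root B (f l x) ^ (2 * r)) powr (1 / (2 * real r)))
         \<le> A * Lp_norm M (2 * real r) (\<lambda>x. form_root B (\<Sum>l = 1..L. f l x)) \<longrightarrow>
       Lp_norm M (2 * real r) (\<lambda>x. sqrt (\<Sum>l = 1..L. (form_root B (f l x))\<^sup>2))
         \<le> C * Lp_norm M (2 * real r) (\<lambda>x. form_root B (\<Sum>l = 1..L. f l x)))"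
proof -
  \<comment> \<open>This is the base of the power in the integrated inequality; the exponent
    \<open>2 * r\<close> disappears when the root is taken.\<close>
  define c :: real where "c = 2 * fact (2 * r)"
  have c: "0 < c" by (simp add: c_def)
  have bound: "c * (1 + A) \<le> const_bound r A"
  proof -
    define t where "t = fact (2 * r) * (1 + A)"
    \<comment> \<open>The bound \<open>2 \<le> t\<close>, which yields
      \<open>2 * t \<le> t ^ 2\<close>, comes from \<open>2 \<le> fact (2 * r)\<close> and
      \<open>1 \<le> 1 + A\<close>.\<close>
    have "fact 2 \<le> (fact (2 * r) :: real)" using assms by (intro fact_mono) auto
    then have "2 * 1 \<le> t" unfolding t_def using assms by (intro mult_mono) auto
    then have t: "2 \<le> t" by simp
    have "c * (1 + A) = 2 * t" by (simp add: c_def t_def)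
    also have "\<dots> \<le> t ^ 2" using t by (simp add: power2_eq_square)
    also have "\<dots> \<le> t ^ (2 * r)" using t assms by (intro power_increasing) auto
    finally show ?thesis by (simp add: const_bound_def t_def)
  qed
  have main: "Lp_norm M (2 * real r) (\<lambda>x. sqrt (\<Sum>l = 1..L. (form_root B (f l x))\<^sup>2))
      \<le> c * (1 + A) * Lp_norm M (2 * real r) (\<lambda>x. form_root B (\<Sum>l = 1..L. f l x))"
    if pos: "positive_form B" and L: "L \<ge> 1"
      and int: "\<forall>l \<in> {1..2 * r} \<rightarrow> {1..L}. integrable M (form_prod B f r l)"
      and zero: "\<forall>l \<in> {1..2 * r} \<rightarrow> {1..L}. inj_on l {1..2 * r} \<longrightarrow> (\<integral>x. form_prod B f r l x \<partial>M) = 0"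
      and le: "Lp_norm M (2 * real r)
           (\<lambda>x. (\<Sum>l = 1..L. form_root B (f l x) ^ (2 * r)) powr (1 / (2 * real r)))
         \<le> A * Lp_norm M (2 * real r) (\<lambda>x. form_root B (\<Sum>l = 1..L. f l x))"
    for M :: "'a measure" and B :: "'v \<Rightarrow> 'v \<Rightarrow> complex" and L and f :: "nat \<Rightarrow> 'a \<Rightarrow> 'v"
  proof -
    let ?p = "1 / (2 * real r)"
    have B0: "0 \<le> Re (B v v)" for v using pos by (simp add: positive_form_def)
    have root: "form_root B v ^ (2 * r) = Re (B v v) ^ r" "(form_root B v)\<^sup>2 = Re (B v v)" for v
      using B0 by (simp_all add: form_root_def power_mult)
    define Q where "Q = (\<integral>x. (\<Sum>m = 1..L. Re (B (f m x) (f m x))) ^ r \<partial>M)"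
    define S where "S = (\<integral>x. Re (B (\<Sum>m = 1..L. f m x) (\<Sum>m = 1..L. f m x)) ^ r \<partial>M)"
    define R where "R = (\<integral>x. (\<Sum>m = 1..L. Re (B (f m x) (f m x)) ^ r) \<partial>M)"
    have nn: "0 \<le> Q" "0 \<le> S" "0 \<le> R"
      unfolding Q_def S_def R_def using B0 by (auto intro!: integral_nonneg_AE AE_I2 zero_le_power sum_nonneg)
    have nS: "Lp_norm M (2 * real r) (\<lambda>x. form_root B (\<Sum>l = 1..L. f l x)) = S powr ?p"
      unfolding Lp_norm_even[OF assms(1)] root S_def ..
    have nQ: "Lp_norm M (2 * real r) (\<lambda>x. sqrt (\<Sum>l = 1..L. (form_root B (f l x))\<^sup>2)) = Q powr ?p"
      unfolding Lp_norm_even[OF assms(1)] root Q_def using B0 by (simp add: power_mult sum_nonneg)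
    have nR: "Lp_norm M (2 * real r)
        (\<lambda>x. (\<Sum>l = 1..L. form_root B (f l x) ^ (2 * r)) powr (1 / (2 * real r))) = R powr ?p"
    proof -
      have "((\<Sum>l = 1..L. Re (B (f l x) (f l x)) ^ r) powr (1 / (2 * real r))) ^ (2 * r)
          = (\<Sum>l = 1..L. Re (B (f l x) (f l x)) ^ r)" for x
        using powr_inverse_power[of "\<Sum>l = 1..L. Re (B (f l x) (f l x)) ^ r" "2 * r"] assms B0
        by (simp add: sum_nonneg)
      then show ?thesis unfolding Lp_norm_even[OF assms(1)] root R_def by simp
    qed
    have inv: "(u powr ?p) ^ (2 * r) = u" if "0 \<le> u" for u
      using powr_inverse_power[OF that, of "2 * r"] assms by simp
    \<comment> \<open>The norm hypothesis, raised to the power \<open>2 * r\<close>, compares the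
      integrals \<open>R\<close> and \<open>S\<close>.\<close>
    have "R = (R powr ?p) ^ (2 * r)" by (rule inv[OF nn(3), symmetric])
    also have "\<dots> \<le> (A * S powr ?p) ^ (2 * r)"
      using le unfolding nR nS by (intro power_mono) auto
    also have "\<dots> = A ^ (2 * r) * S" using nn by (simp only: power_mult_distrib inv)
    finally have R: "R \<le> A ^ (2 * r) * S" .
    have "Q \<le> c ^ (2 * r) * (S + R)"
      unfolding Q_def S_def R_def c_def
      by (rule integral_square_fn_le) (use pos L int zero assms in auto)
    also have "\<dots> \<le> c ^ (2 * r) * (S + A ^ (2 * r) * S)"
      using R c by (intro mult_left_mono) auto
    also have "\<dots> = c ^ (2 * r) * ((1 + A ^ (2 * r)) * S)" by (simp add: distrib_right)
    \<comment> \<open>Replacing \<open>1 + A ^ (2 * r)\<close> by a pure power makes the right-hand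
      side a \<open>2 * r\<close>-th power, whose root can be taken.\<close>
    also have "\<dots> \<le> c ^ (2 * r) * ((1 + A) ^ (2 * r) * S)"
      using one_plus_power_le[of A "2 * r"] assms nn c
      by (intro mult_left_mono mult_right_mono) auto
    also have "\<dots> = (c * (1 + A) * S powr ?p) ^ (2 * r)"
      using nn by (simp only: power_mult_distrib inv mult.assoc)
    finally have "(Q powr ?p) ^ (2 * r) \<le> (c * (1 + A) * S powr ?p) ^ (2 * r)"
      unfolding inv[OF nn(1)] .
    then have "Q powr ?p \<le> c * (1 + A) * S powr ?p"
      using assms c by (subst (asm) power_mono_iff) auto
    then show ?thesis unfolding nQ nS .
  qed
  show ?thesis
  proof (intro exI[of _ "c * (1 + A)"] conjI allI impI)
    show "0 < c * (1 + A)" using c assms by simp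
  qed (fact bound, rule main)
qed

end
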